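(* Let $\mathcal V$ be a variety of ai-semirings containing the four ai-semirings $H$, $D$, $G_2$ and $G_3$. Suppose that $\mathcal V$ satisfies the identity $\sigma_n$ for infinitely many $n\in\mathcal N=\{n\in\mathbb N: n\ge 7,\ n\equiv 1\pmod 3\}$. Then $\mathcal V$ has no equational basis whose identities involve a bounded number of variables; that is, there are no natural number $k$ and set $\Sigma$ of identities, each involving at most $k$ distinct variables, such that $\Sigma$ defines $\mathcal V$. In particular, $\mathcal V$ is nonfinitely based.
   Context: An additively idempotent semiring (ai-semiring) is an algebra $(S,+,\cdot)$ of signature $(+,\cdot)$, without constants, such that $(S,+)$ is a commutative idempotent semigroup, $(S,\cdot)$ is a semigroup, and $x(y+z)=xy+xz$, $(x+y)z=xz+yz$ hold. A variety is nonfinitely based if it cannot be defined by finitely many identities. The ai-semirings: $H=\{1,a,a^2,\infty\}$ is the chain $1<a<a^2<\infty$ with maximum as addition; with $a^0=1$, $a^3=\infty$, its multiplication is $a^ia^j=a^{\min\{i+j,3\}}$ for $0\le i,j\le 3$. $D$ is the two-element distributive lattice with join as addition and meet as multiplication. For $p\in\{2,3\}$, $G_p=C_p\cup\{\infty\}$ where $C_p$ is the cyclic group of order $p$ and $\infty\notin C_p$; addition is $u+v=u$ if $u=v$ and $u+v=\infty$ if $u\neq v$; multiplication extends that of $C_p$ with $\infty$ absorbing. The identities: for terms $\mathbf u,\mathbf v$, $\mathbf v\preceq\mathbf u$ denotes the identity $\mathbf u+\mathbf v\approx\mathbf u$. For $n\in\mathcal N$ let $x_1,\dots,x_n,y_1,\dots,y_n,z$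 be pairwise distinct variables, with the subscripts of the $y$-variables read modulo $n$. Put $p_n=x_1^2x_2^2\cdots x_n^2$, $a_n=x_1^2z$, $q_n=p_nz$, and $$\mathbf f_n=p_n+a_n+\sum_{i=1}^n y_iy_{i+1}y_{i+2}x_i^2z,$$ with the products in the displayed order (multiplication is not assumed commutative). Then $\sigma_n$ is the identity $q_n\preceq\mathbf f_n$. *)

theory Defs
  imports "HOL-Algebra.Elementary_Groups"
begin

section \<open>Algebras of signature $(+,\cdot)$ and ai-semirings\<close>

record 'a ai_alg = "'a partial_object" +
  ai_plus :: "'a \<Rightarrow> 'a \<Rightarrow> 'a"  (infixl \<open>+\<index>\<close> 65)
  ai_times :: "'a \<Rightarrow> 'a \<Rightarrow> 'a"  (infixl \<open>\<cdot>\<index>\<close> 70)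

locale ai_algebra =
  fixes S :: "('a, 'm) ai_alg_scheme" (structure)
  assumes nonempty: "carrier S \<noteq> {}"
    and plus_closed: "\<lbrakk>x \<in> carrier S; y \<in> carrier S\<rbrakk> \<Longrightarrow> x +\<^bsub>S\<^esub> y \<in> carrier S"
    and times_closed: "\<lbrakk>x \<in> carrier S; y \<in> carrier S\<rbrakk> \<Longrightarrow> x \<cdot>\<^bsub>S\<^esub> y \<in> carrier S"

locale ai_semiring = ai_algebra +
  assumes plus_assoc: "\<lbrakk>x \<in> carrier S; y \<in> carrier S; z \<in> carrier S\<rbrakk>
      \<Longrightarrow> (x +\<^bsub>S\<^esub> y) +\<^bsub>S\<^esub> z = x +\<^bsub>S\<^esub> (y +\<^bsub>S\<^esub> z)"
    and plus_comm: "\<lbrakk>x \<in> carrier S; y \<in> carrier S\<rbrakk> \<Longrightarrow> x +\<^bsub>S\<^esub> y = y +\<^bsub>S\<^esub> x"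
    and plus_idem: "x \<in> carrier S \<Longrightarrow> x +\<^bsub>S\<^esub> x = x"
    and times_assoc: "\<lbrakk>x \<in> carrier S; y \<in> carrier S; z \<in> carrier S\<rbrakk>
      \<Longrightarrow> (x \<cdot>\<^bsub>S\<^esub> y) \<cdot>\<^bsub>S\<^esub> z = x \<cdot>\<^bsub>S\<^esub> (y \<cdot>\<^bsub>S\<^esub> z)"
    and distrib_left: "\<lbrakk>x \<in> carrier S; y \<in> carrier S; z \<in> carrier S\<rbrakk>
      \<Longrightarrow> x \<cdot>\<^bsub>S\<^esub> (y +\<^bsub>S\<^esub> z) = x \<cdot>\<^bsub>S\<^esub> y +\<^bsub>S\<^esub> x \<cdot>\<^bsub>S\<^esub> z"
    and distrib_right: "\<lbrakk>x \<in> carrier S; y \<in> carrier S; z \<in> carrier S\<rbrakk>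
      \<Longrightarrow> (x +\<^bsub>S\<^esub> y) \<cdot>\<^bsub>S\<^esub> z = x \<cdot>\<^bsub>S\<^esub> z +\<^bsub>S\<^esub> y \<cdot>\<^bsub>S\<^esub> z"

definition ai_iso ::
  "('a, 'm) ai_alg_scheme \<Rightarrow> ('b, 'k) ai_alg_scheme \<Rightarrow> ('a \<Rightarrow> 'b) set" where
  "ai_iso A B = {h. bij_betw h (carrier A) (carrier B) \<and>
     (\<forall>x\<in>carrier A. \<forall>y\<in>carrier A.
        h (x +\<^bsub>A\<^esub> y) = h x +\<^bsub>B\<^esub> h y \<and> h (x \<cdot>\<^bsub>A\<^esub> y) = h x \<cdot>\<^bsub>B\<^esub> h y)}"


section \<open>Terms, identities, varieties\<close>

datatype (vars: 'v) ai_term =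
    Var 'v
  | Plus "'v ai_term" "'v ai_term"
  | Times "'v ai_term" "'v ai_term"

type_synonym 'v identity = "'v ai_term \<times> 'v ai_term"

primrec eval :: "('a, 'm) ai_alg_scheme \<Rightarrow> ('v \<Rightarrow> 'a) \<Rightarrow> 'v ai_term \<Rightarrow> 'a" where
  "eval S \<rho> (Var v) = \<rho> v"
| "eval S \<rho> (Plus s t) = eval S \<rho> s +\<^bsub>S\<^esub> eval S \<rho> t"
| "eval S \<rho> (Times s t) = eval S \<rho> s \<cdot>\<^bsub>S\<^esub> eval S \<rho> t"

definition satisfies :: "('a, 'm) ai_alg_scheme \<Rightarrow> 'v identity \<Rightarrow> bool" where
  "satisfies S e \<longleftrightarrow>
     (\<forall>\<rho>. (\<forall>v. \<rho> v \<in> carrier S) \<longrightarrow> eval S \<rho> (fst e) = eval S \<rho> (snd e))"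

definition id_vars :: "'v identity \<Rightarrow> 'v set" where
  "id_vars e = vars (fst e) \<union> vars (snd e)"

text \<open>
  Varieties are treated as equational classes, over the countably infinite set
  of variables \<open>nat\<close>.  HOL has no class of all algebras, so a class of
  algebras is a set of algebras whose carriers are subsets of a type \<open>'a\<close>.
  If \<open>'a\<close> is infinite, no information about equational logic is lost:
  an identity that fails in an algebra fails in a countable subalgebra, so two
  sets of identities have the same models with carrier in \<open>'a\<close> if and only
  if they have the same models altogether.  For finite \<open>'a\<close> this is false.
\<close>

definition models :: "nat identity set \<Rightarrow> 'a ai_alg set" where
  "models E = {S. ai_algebra S \<and> (\<forall>e\<in>E. satisfies S e)}"

definition defines_variety :: "nat identity set \<Rightarrow> 'a ai_alg set \<Rightarrow> bool" where
  "defines_variety \<Sigma> V \<longleftrightarrow> V = models \<Sigma>"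

definition variety :: "'a ai_alg set \<Rightarrow> bool" where
  "variety V \<longleftrightarrow> (\<exists>E. defines_variety E V)"

definition ai_semiring_variety :: "'a ai_alg set \<Rightarrow> bool" where
  "ai_semiring_variety V \<longleftrightarrow> variety V \<and> (\<forall>S\<in>V. ai_semiring S)"

definition variety_satisfies :: "'a ai_alg set \<Rightarrow> 'v identity \<Rightarrow> bool" where
  "variety_satisfies V e \<longleftrightarrow> (\<forall>S\<in>V. satisfies S e)"

text \<open>The algebra \<open>A\<close> may live on a different type, so containment is up to isomorphism.\<close>

definition variety_contains :: "'a ai_alg set \<Rightarrow> 'b ai_alg \<Rightarrow> bool" where
  "variety_contains V A \<longleftrightarrow> (\<exists>S\<in>V. ai_iso A S \<noteq> {})"

definition bounded_variable_basis :: "'a ai_alg set \<Rightarrow> bool" where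
  "bounded_variable_basis V \<longleftrightarrow>
     (\<exists>(k::nat) \<Sigma>. (\<forall>e\<in>\<Sigma>. card (id_vars e) \<le> k) \<and> defines_variety \<Sigma> V)"

definition nonfinitely_based :: "'a ai_alg set \<Rightarrow> bool" where
  "nonfinitely_based V \<longleftrightarrow> \<not> (\<exists>\<Sigma>. finite \<Sigma> \<and> defines_variety \<Sigma> V)"


section \<open>The semirings $H$, $D$ and $G_p$\<close>

text \<open>The number \<open>i\<close> stands for $a^i$, so 0 is the identity element and 3 is $\infty$.\<close>

definition H_alg :: "nat ai_alg" where
  "H_alg = \<lparr>carrier = {0..3}, ai_plus = max, ai_times = (\<lambda>i j. min (i + j) 3)\<rparr>"

definition D_alg :: "bool ai_alg" where
  "D_alg = \<lparr>carrier = UNIV, ai_plus = (\<or>), ai_times = (\<and>)\<rparr>"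

text \<open>\<open>None\<close> plays the role of $\infty$.\<close>

fun flat_times :: "('a, 'm) monoid_scheme \<Rightarrow> 'a option \<Rightarrow> 'a option \<Rightarrow> 'a option" where
  "flat_times C (Some u) (Some v) = Some (u \<otimes>\<^bsub>C\<^esub> v)"
| "flat_times C _ _ = None"

definition flat_extension :: "('a, 'm) monoid_scheme \<Rightarrow> 'a option ai_alg" where
  "flat_extension C =
     \<lparr>carrier = insert None (Some ` carrier C),
      ai_plus = (\<lambda>u v. if u = v then u else None),
      ai_times = flat_times C\<rparr>"

definition G_alg :: "nat \<Rightarrow> int option ai_alg" where
  "G_alg p = flat_extension (integer_mod_group p)"


section \<open>The identities $\sigma_n$\<close>

text \<open>Finite sums and products of terms; only meant for nonempty lists.\<close>

definition sum_terms :: "'v ai_term list \<Rightarrow> 'v ai_term" where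
  "sum_terms ts = foldl Plus (hd ts) (tl ts)"

definition prod_terms :: "'v ai_term list \<Rightarrow> 'v ai_term" where
  "prod_terms ts = foldl Times (hd ts) (tl ts)"

definition preceq :: "'v ai_term \<Rightarrow> 'v ai_term \<Rightarrow> 'v identity"  (infix \<open>\<preceq>\<close> 50) where
  "v \<preceq> u = (Plus u v, u)"

datatype sigma_var = X nat | Y nat | Z

definition x_t :: "nat \<Rightarrow> sigma_var ai_term" where "x_t i = Var (X i)"

text \<open>Subscripts are read modulo \<open>n\<close>; the residue 0 represents the subscript \<open>n\<close>.\<close>

definition y_t :: "nat \<Rightarrow> nat \<Rightarrow> sigma_var ai_term" where "y_t n i = Var (Y (i mod n))"

definition z_t :: "sigma_var ai_term" where "z_t = Var Z"

definition p_t :: "nat \<Rightarrow> sigma_var ai_term" where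
  "p_t n = prod_terms (concat (map (\<lambda>i. [x_t i, x_t i]) [1..<n+1]))"

definition a_t :: "sigma_var ai_term" where
  "a_t = prod_terms [x_t 1, x_t 1, z_t]"

definition q_t :: "nat \<Rightarrow> sigma_var ai_term" where
  "q_t n = Times (p_t n) z_t"

definition f_t :: "nat \<Rightarrow> sigma_var ai_term" where
  "f_t n = Plus (Plus (p_t n) a_t)
     (sum_terms (map (\<lambda>i. prod_terms
        [y_t n i, y_t n (i+1), y_t n (i+2), x_t i, x_t i, z_t]) [1..<n+1]))"

definition sigma :: "nat \<Rightarrow> sigma_var identity" where
  "sigma n = (q_t n \<preceq> f_t n)"

definition index_set :: "nat set" where
  "index_set = {n. n \<ge> 7 \<and> n mod 3 = 1}"

end

theory Submission
  imports Defs "HOL-Library.Multiset"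
begin

text \<open>
  Fix \<open>n > k\<close> and let \<open>F\<close> be the set of words of \<open>f\<^sub>n\<close>. Identify sets \<open>U\<close> of words with the same
  contexts \<open>c\<close> for which \<open>c U \<subseteq> F\<close>. The resulting finite semiring fails \<open>\<sigma>\<^sub>n\<close>, because
  \<open>q\<^sub>n\<close> is not in \<open>F\<close>. It satisfies every identity \<open>s \<approx> t\<close> in at most \<open>k\<close> variables that holds in
  \<open>H\<close>, \<open>D\<close>, \<open>G\<^sub>2\<close>, \<open>G\<^sub>3\<close>: if \<open>c \<rho>(s) \<subseteq> F\<close> and \<open>w\<close> is a word of \<open>\<rho>(t)\<close>, then these four semirings force
  \<open>N = c w\<close> to lie in \<open>F\<close> or to be the product of \<open>z\<close> and of some squares \<open>x\<^sub>i\<^sup>2\<close>, not only of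
  \<open>x\<^sub>1\<^sup>2\<close>. In the second case an exchange argument shows that \<open>w\<close> uses one word for each variable, so \<open>\<rho>\<close> may be
  assumed to take single words as values. Distinct words \<open>y\<^sub>i y\<^sub>i\<^sub>+\<^sub>1 y\<^sub>i\<^sub>+\<^sub>2 x\<^sub>i\<^sup>2 z\<close> in \<open>c \<rho>(s)\<close> then
  require distinct variables of \<open>s\<close>, so one of them is missing. Without it there is a \<open>G\<^sub>3\<close>-valued
  assignment that is constant on \<open>c \<rho>(s)\<close> and takes another value at \<open>N\<close>.
\<close>

section \<open>Homomorphisms and homomorphic images\<close>

lemma (in ai_algebra) eval_closed:
  assumes "\<And>v. \<rho> v \<in> carrier S"
  shows "eval S \<rho> t \<in> carrier S"
  by (induction t) (auto simp: assms plus_closed times_closed)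

lemma (in ai_algebra) eval_hom:
  assumes plus: "\<And>x y. x \<in> carrier S \<Longrightarrow> y \<in> carrier S \<Longrightarrow> h (x +\<^bsub>S\<^esub> y) = h x +\<^bsub>T\<^esub> h y"
    and times: "\<And>x y. x \<in> carrier S \<Longrightarrow> y \<in> carrier S \<Longrightarrow> h (x \<cdot>\<^bsub>S\<^esub> y) = h x \<cdot>\<^bsub>T\<^esub> h y"
    and \<rho>: "\<And>v. \<rho> v \<in> carrier S"
  shows "h (eval S \<rho> t) = eval T (h \<circ> \<rho>) t"
  by (induction t) (auto simp: plus times eval_closed[OF \<rho>])

lemma (in ai_algebra) satisfies_iso:
  fixes e :: "'v identity"
  assumes "h \<in> ai_iso S T" and "satisfies T e"
  shows "satisfies S e"
  unfolding satisfies_def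
proof (intro allI impI)
  fix \<rho> :: "'v \<Rightarrow> 'a" assume \<rho>: "\<forall>v. \<rho> v \<in> carrier S"
  have bij: "bij_betw h (carrier S) (carrier T)"
    using assms(1) by (simp add: ai_iso_def)
  have hom: "h (eval S \<rho> t) = eval T (h \<circ> \<rho>) t" for t :: "'v ai_term"
    using assms(1) \<rho> by (intro eval_hom) (auto simp: ai_iso_def)
  have "\<forall>v. (h \<circ> \<rho>) v \<in> carrier T"
    using bij \<rho> by (auto simp: bij_betw_def)
  then have "eval T (h \<circ> \<rho>) (fst e) = eval T (h \<circ> \<rho>) (snd e)"
    using assms(2) by (auto simp: satisfies_def)
  then have "h (eval S \<rho> (fst e)) = h (eval S \<rho> (snd e))"
    by (simp only: hom)
  then show "eval S \<rho> (fst e) = eval S \<rho> (snd e)"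
    using bij \<rho> by (auto simp: bij_betw_def inj_on_def eval_closed)
qed

lemma satisfies_sym: "satisfies S (s, t) \<Longrightarrow> satisfies S (t, s)"
  by (simp add: satisfies_def)

lemma satisfies_variety_contains:
  assumes "variety_contains V A" and "ai_algebra A" and "variety_satisfies V e"
  shows "satisfies A e"
  using assms ai_algebra.satisfies_iso[OF assms(2)]
  unfolding variety_contains_def variety_satisfies_def by blast

section \<open>Quotients carried by an arbitrary type\<close>

text \<open>The quotient of \<open>S\<close> by the kernel of \<open>h\<close>, computed on
  representatives. Since the codomain of \<open>h\<close> is free, the quotient can be placed on the
  type over which the variety lives.\<close>

definition image_alg :: "('a \<Rightarrow> 'b) \<Rightarrow> ('a, 'm) ai_alg_scheme \<Rightarrow> 'b ai_alg" where
  "image_alg h S =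
     \<lparr>carrier = h ` carrier S,
      ai_plus = (\<lambda>x y. h (inv_into (carrier S) h x +\<^bsub>S\<^esub> inv_into (carrier S) h y)),
      ai_times = (\<lambda>x y. h (inv_into (carrier S) h x \<cdot>\<^bsub>S\<^esub> inv_into (carrier S) h y))\<rparr>"

locale ai_congruence = ai_algebra +
  fixes h :: "'a \<Rightarrow> 'c"
  assumes cong_plus: "\<lbrakk>x \<in> carrier S; x' \<in> carrier S; y \<in> carrier S; y' \<in> carrier S; h x = h x'; h y = h y'\<rbrakk>
      \<Longrightarrow> h (x +\<^bsub>S\<^esub> y) = h (x' +\<^bsub>S\<^esub> y')"
    and cong_times: "\<lbrakk>x \<in> carrier S; x' \<in> carrier S; y \<in> carrier S; y' \<in> carrier S; h x = h x'; h y = h y'\<rbrakk>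
      \<Longrightarrow> h (x \<cdot>\<^bsub>S\<^esub> y) = h (x' \<cdot>\<^bsub>S\<^esub> y')"
begin

lemma image_alg_hom:
  assumes "x \<in> carrier S" and "y \<in> carrier S"
  shows "h (x +\<^bsub>S\<^esub> y) = h x +\<^bsub>image_alg h S\<^esub> h y"
    and "h (x \<cdot>\<^bsub>S\<^esub> y) = h x \<cdot>\<^bsub>image_alg h S\<^esub> h y"
  unfolding image_alg_def
  by (auto intro!: cong_plus cong_times simp: assms inv_into_into f_inv_into_f)

lemma ai_algebra_image_alg: "ai_algebra (image_alg h S)"
proof
  show "carrier (image_alg h S) \<noteq> {}"
    using nonempty by (simp add: image_alg_def)
qed (auto simp: image_alg_def intro!: imageI plus_closed times_closed inv_into_into)

lemma eval_image_alg:
  assumes "\<And>v. \<rho> v \<in> carrier S"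
  shows "eval (image_alg h S) (h \<circ> \<rho>) t = h (eval S \<rho> t)"
  using assms by (intro eval_hom[symmetric]) (auto intro: image_alg_hom)

text \<open>Every assignment into the image lifts to representatives, so an identity of the quotient
  can be tested in \<open>S\<close>, up to \<open>h\<close>.\<close>

lemma satisfies_image_alg_iff:
  fixes e :: "'v identity"
  shows "satisfies (image_alg h S) e \<longleftrightarrow>
     (\<forall>\<rho>. (\<forall>v. \<rho> v \<in> carrier S) \<longrightarrow> h (eval S \<rho> (fst e)) = h (eval S \<rho> (snd e)))"
    (is "?l \<longleftrightarrow> ?r")
proof
  assume l: ?l
  show ?r
  proof (intro allI impI)
    fix \<rho> :: "'v \<Rightarrow> 'a" assume \<rho>: "\<forall>v. \<rho> v \<in> carrier S"
    then have "\<forall>v. (h \<circ> \<rho>) v \<in> carrier (image_alg h S)"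
      by (simp add: image_alg_def)
    with l have "eval (image_alg h S) (h \<circ> \<rho>) (fst e) = eval (image_alg h S) (h \<circ> \<rho>) (snd e)"
      unfolding satisfies_def by blast
    then show "h (eval S \<rho> (fst e)) = h (eval S \<rho> (snd e))"
      using \<rho> by (simp add: eval_image_alg)
  qed
next
  assume r: ?r
  show ?l
    unfolding satisfies_def
  proof (intro allI impI)
    fix \<tau> :: "'v \<Rightarrow> 'c" assume \<tau>: "\<forall>v. \<tau> v \<in> carrier (image_alg h S)"
    define \<rho> where "\<rho> = inv_into (carrier S) h \<circ> \<tau>"
    have \<rho>: "\<And>v. \<rho> v \<in> carrier S" and "\<tau> = h \<circ> \<rho>"
      using \<tau> by (auto simp: \<rho>_def image_alg_def inv_into_into f_inv_into_f)
    then show "eval (image_alg h S) \<tau> (fst e) = eval (image_alg h S) \<tau> (snd e)"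
      using r by (simp add: eval_image_alg)
  qed
qed

end


section \<open>Sets of multisets\<close>

text \<open>Multiplication in the four given semirings is commutative, so words are only needed up to
  permutation.\<close>

definition mset_alg :: "'c multiset set ai_alg" where
  "mset_alg = \<lparr>carrier = {U. U \<noteq> {}}, ai_plus = (\<union>), ai_times = (\<lambda>U V. {u + v | u v. u \<in> U \<and> v \<in> V})\<rparr>"

lemma mset_alg_simps [simp]:
  "carrier mset_alg = {U. U \<noteq> {}}"
  "U +\<^bsub>mset_alg\<^esub> V = U \<union> V"
  "U \<cdot>\<^bsub>mset_alg\<^esub> V = {u + v | u v. u \<in> U \<and> v \<in> V}"
  by (simp_all add: mset_alg_def)

interpretation mset_alg: ai_algebra mset_alg
  by standard auto

lemma eval_mset_alg_mono:
  assumes "\<And>v. \<rho> v \<subseteq> \<rho>' v"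
  shows "eval mset_alg \<rho> t \<subseteq> eval mset_alg \<rho>' t"
  using assms by (induction t) (simp; blast)+

section \<open>Recording which word is substituted at each occurrence of a variable\<close>

text \<open>Each substituted word is tagged with the variable that it replaces, so \<open>M\<close>
  records the choices that produce \<open>w\<close>.\<close>

lemma eval_mset_alg_tagged:
  assumes "w \<in> eval mset_alg \<rho> t"
  obtains M where "M \<in> eval mset_alg (\<lambda>v. (\<lambda>u. {#(v, u)#}) ` \<rho> v) t" "w = \<Sum>\<^sub># (image_mset snd M)"
proof -
  have "\<exists>M \<in> eval mset_alg (\<lambda>v. (\<lambda>u. {#(v, u)#}) ` \<rho> v) t. w = \<Sum>\<^sub># (image_mset snd M)"
    using assms
  proof (induction t arbitrary: w)
    case (Times s t)
    then obtain u v where uv: "w = u + v" "u \<in> eval mset_alg \<rho> s" "v \<in> eval mset_alg \<rho> t"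
      by auto
    from Times.IH(1)[OF uv(2)] Times.IH(2)[OF uv(3)] show ?case
      by (fastforce simp: uv(1))
  qed auto
  then show thesis
    using that by blast
qed

text \<open>A record made under \<open>\<rho>\<close> can be replayed under any
  \<open>\<rho>'\<close> that still offers the recorded choices. This later shrinks
  \<open>\<rho>\<close> to one word per variable.\<close>

lemma eval_mset_alg_untag:
  assumes "M \<in> eval mset_alg (\<lambda>v. (\<lambda>u. {#(v, u)#}) ` \<rho> v) t"
    and "\<And>v u. (v, u) \<in># M \<Longrightarrow> u \<in> \<rho>' v"
  shows "\<Sum>\<^sub># (image_mset snd M) \<in> eval mset_alg \<rho>' t"
  using assms
proof (induction t arbitrary: M)
  case (Times s t)
  from Times.prems(1) obtain M1 M2 where "M = M1 + M2"
    "M1 \<in> eval mset_alg (\<lambda>v. (\<lambda>u. {#(v, u)#}) ` \<rho> v) s"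
    "M2 \<in> eval mset_alg (\<lambda>v. (\<lambda>u. {#(v, u)#}) ` \<rho> v) t"
    by auto
  with Times.IH(1)[of M1] Times.IH(2)[of M2] Times.prems(2) show ?case
    by fastforce
qed auto

lemma eval_mset_alg_tag_mem:
  assumes "M \<in> eval mset_alg (\<lambda>v. (\<lambda>u. {#(v, u)#}) ` \<rho> v) t" and "(v, u) \<in># M"
  shows "u \<in> \<rho> v"
  using assms by (induction t arbitrary: M) auto

text \<open>Choices at different occurrences of a variable are independent, because sets are
  multiplied elementwise.\<close>

lemma eval_mset_alg_exchange:
  assumes "M \<in> eval mset_alg (\<lambda>v. (\<lambda>u. {#(v, u)#}) ` \<rho> v) t"
    and "(v, u) \<in># M" and "u' \<in> \<rho> v"
  shows "add_mset (v, u') (M - {#(v, u)#}) \<in> eval mset_alg (\<lambda>v. (\<lambda>u. {#(v, u)#}) ` \<rho> v) t"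
  using assms
proof (induction t arbitrary: M)
  case (Times s t)
  from Times.prems(1) obtain M1 M2 where M: "M = M1 + M2"
    "M1 \<in> eval mset_alg (\<lambda>v. (\<lambda>u. {#(v, u)#}) ` \<rho> v) s"
    "M2 \<in> eval mset_alg (\<lambda>v. (\<lambda>u. {#(v, u)#}) ` \<rho> v) t"
    by auto
  then consider "(v, u) \<in># M1" | "(v, u) \<in># M2"
    using Times.prems(2) by auto
  then show ?case
  proof cases
    case 1
    then have "add_mset (v, u') (M - {#(v, u)#}) = add_mset (v, u') (M1 - {#(v, u)#}) + M2"
      by (simp add: M(1) multiset_eq_iff)
    with Times.IH(1)[OF M(2) 1 Times.prems(3)] M(3) show ?thesis
      unfolding eval.simps mset_alg_simps by blast
  next
    case 2
    then have "add_mset (v, u') (M - {#(v, u)#}) = M1 + add_mset (v, u') (M2 - {#(v, u)#})"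
      by (simp add: M(1) multiset_eq_iff)
    with Times.IH(2)[OF M(3) 2 Times.prems(3)] M(2) show ?thesis
      unfolding eval.simps mset_alg_simps by blast
  qed
qed auto

text \<open>Serves to charge a letter of \<open>w\<close> to a variable of \<open>t\<close> that
  contributes it.\<close>

lemma eval_mset_alg_var_mem:
  assumes "w \<in> eval mset_alg (\<lambda>v. {\<psi> v}) t" and "a \<in># w"
  obtains v where "v \<in> vars t" "a \<in># \<psi> v" "\<psi> v \<subseteq># w"
proof -
  have "\<exists>v \<in> vars t. a \<in># \<psi> v \<and> \<psi> v \<subseteq># w"
    using assms
  proof (induction t arbitrary: w)
    case (Times s t)
    then obtain u v where uv: "w = u + v" "u \<in> eval mset_alg (\<lambda>v. {\<psi> v}) s" "v \<in> eval mset_alg (\<lambda>v. {\<psi> v}) t"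
      by auto
    then consider "a \<in># u" | "a \<in># v"
      using Times.prems by auto
    then show ?case
    proof cases
      case 1
      with Times.IH(1)[OF uv(2)] uv(1) show ?thesis
        by simp (meson UnI1 mset_subset_eq_add_left subset_mset.order_trans)
    next
      case 2
      with Times.IH(2)[OF uv(3)] uv(1) show ?thesis
        by simp (meson UnI2 mset_subset_eq_add_right subset_mset.order_trans)
    qed
  qed auto
  then show thesis
    using that by blast
qed

lemma eval_mset_alg_prod_terms:
  assumes "vs \<noteq> []"
  shows "eval mset_alg (\<lambda>v. {{#v#}}) (prod_terms (map Var vs)) = {mset vs}"
proof -
  have "eval mset_alg (\<lambda>v. {{#v#}}) (foldl Times t (map Var vs)) =
      {u + mset vs | u. u \<in> eval mset_alg (\<lambda>v. {{#v#}}) t}" for t :: "'a ai_term" and vs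
    by (induction vs arbitrary: t) auto
  with assms show ?thesis
    by (cases vs) (auto simp: prod_terms_def)
qed

lemma eval_mset_alg_sum_terms:
  assumes "ts \<noteq> []"
  shows "eval mset_alg \<rho> (sum_terms ts) = (\<Union>t \<in> set ts. eval mset_alg \<rho> t)"
proof -
  have "eval mset_alg \<rho> (foldl Plus t ts) = eval mset_alg \<rho> t \<union> (\<Union>t \<in> set ts. eval mset_alg \<rho> t)" for t ts
    by (induction ts arbitrary: t) auto
  with assms show ?thesis
    by (cases ts) (auto simp: sum_terms_def)
qed


section \<open>Consequences of the identities of $H$, $D$ and $G_p$\<close>

text \<open>Here \<open>\<alpha>\<close> gives exponents of elements of H. A word takes the value of
  its exponent sum truncated at 3, a set of words the maximum, and \<open>N\<close> may not exceed
  \<open>B\<close>.\<close>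

definition H_below :: "'c multiset set \<Rightarrow> 'c multiset \<Rightarrow> bool" where
  "H_below B N \<longleftrightarrow> (\<forall>\<alpha> :: 'c \<Rightarrow> nat. \<exists>b\<in>B. min 3 (\<Sum>a\<in>#N. \<alpha> a) \<le> (\<Sum>a\<in>#b. \<alpha> a))"

text \<open>The only assignment into D that needs testing sends exactly the letters of
  \<open>N\<close> to the top element.\<close>

definition D_below :: "'c multiset set \<Rightarrow> 'c multiset \<Rightarrow> bool" where
  "D_below B N \<longleftrightarrow> (\<exists>b\<in>B. set_mset b \<subseteq> set_mset N)"

text \<open>A sum in the flat extension stays in the group only if all summands agree; then the
  value of \<open>N\<close> has to agree as well.\<close>

definition G_below :: "nat \<Rightarrow> 'c multiset set \<Rightarrow> 'c multiset \<Rightarrow> bool" where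
  "G_below p B N \<longleftrightarrow> (\<forall>(\<alpha> :: 'c \<Rightarrow> int) g.
     (\<forall>b\<in>B. (\<Sum>a\<in>#b. \<alpha> a) mod int p = g) \<longrightarrow> (\<Sum>a\<in>#N. \<alpha> a) mod int p = g)"

lemma G_below_mono:
  assumes "G_below p B N" and "B \<subseteq> B'"
  shows "G_below p B' N"
  using assms unfolding G_below_def by (meson subsetD)

lemma ai_algebra_H_alg: "ai_algebra H_alg"
  by standard (auto simp: H_alg_def)

lemma ai_algebra_D_alg: "ai_algebra D_alg"
  by standard (auto simp: D_alg_def)

lemma ai_algebra_G_alg:
  assumes "p > 0"
  shows "ai_algebra (G_alg p)"
proof
  fix x y assume "x \<in> carrier (G_alg p)" "y \<in> carrier (G_alg p)"
  then show "x \<cdot>\<^bsub>G_alg p\<^esub> y \<in> carrier (G_alg p)"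
    using assms by (auto simp: G_alg_def flat_extension_def integer_mod_group_def)
qed (auto simp: G_alg_def flat_extension_def)

text \<open>The maximum of the truncated weights \<open>f\<close> over a set of words is a
  homomorphism into \<open>H_alg\<close>. Truncated addition is monotone, so the context
  \<open>c\<close> can be added afterwards.\<close>

lemma H_below_eval:
  fixes \<rho> :: "'v \<Rightarrow> 'c multiset set"
  assumes "satisfies H_alg (s, t)" and "\<And>v. \<rho> v \<noteq> {}" and w: "w \<in> eval mset_alg \<rho> t"
  shows "H_below ((+) c ` eval mset_alg \<rho> s) (c + w)"
  unfolding H_below_def
proof
  fix \<alpha> :: "'c \<Rightarrow> nat"
  define f where "f u = min 3 (\<Sum>a\<in>#u. \<alpha> a)" for u
  define h where "h U = Max (f ` U)" for U
  have fin: "finite (f ` U)" for U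
    by (rule finite_subset[of _ "{0..3}"]) (auto simp: f_def)
  have f_add: "f (u + v) = min (f u + f v) 3" for u v
    by (auto simp: f_def)
  have hom: "h (eval mset_alg \<rho> r) = eval H_alg (h \<circ> \<rho>) r" for r :: "'v ai_term"
  proof (rule mset_alg.eval_hom)
    fix U V :: "'c multiset set" assume "U \<in> carrier mset_alg" "V \<in> carrier mset_alg"
    then have ne: "U \<noteq> {}" "V \<noteq> {}" by auto
    then show "h (U +\<^bsub>mset_alg\<^esub> V) = h U +\<^bsub>H_alg\<^esub> h V"
      by (simp add: h_def H_alg_def image_Un Max_Un fin)
    show "h (U \<cdot>\<^bsub>mset_alg\<^esub> V) = h U \<cdot>\<^bsub>H_alg\<^esub> h V"
    proof -
      from ne have "h U \<in> f ` U" "h V \<in> f ` V"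
        by (simp_all add: h_def fin Max_in)
      then obtain u v where uv: "u \<in> U" "v \<in> V" "h U = f u" "h V = f v"
        by auto
      have "Max (f ` {u + v | u v. u \<in> U \<and> v \<in> V}) = min (h U + h V) 3"
      proof (rule Max_eqI[OF fin])
        fix y assume "y \<in> f ` {u + v | u v. u \<in> U \<and> v \<in> V}"
        then obtain u' v' where "u' \<in> U" "v' \<in> V" "y = min (f u' + f v') 3"
          by (auto simp: f_add)
        moreover from this have "f u' \<le> h U" "f v' \<le> h V"
          by (simp_all add: h_def fin)
        ultimately show "y \<le> min (h U + h V) 3"
          by linarith
      next
        show "min (h U + h V) 3 \<in> f ` {u + v | u v. u \<in> U \<and> v \<in> V}"
          using uv f_add[of u v] by (auto intro!: image_eqI[of _ f "u + v"])
      qed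
      then show ?thesis
        by (simp add: h_def H_alg_def)
    qed
  qed (use assms in auto)
  have "h U \<in> {0..3}" if "U \<noteq> {}" for U
  proof -
    have "h U \<in> f ` U"
      using that by (simp add: h_def fin Max_in)
    then show ?thesis by (auto simp: f_def)
  qed
  then have "eval H_alg (h \<circ> \<rho>) s = eval H_alg (h \<circ> \<rho>) t"
    using assms(1,2) by (auto simp: satisfies_def H_alg_def)
  then have "h (eval mset_alg \<rho> s) = h (eval mset_alg \<rho> t)"
    by (simp only: hom)
  moreover have "f w \<le> h (eval mset_alg \<rho> t)"
    using w by (simp add: h_def fin)
  moreover have "h (eval mset_alg \<rho> s) \<in> f ` eval mset_alg \<rho> s"
    using mset_alg.eval_closed[of \<rho> s] assms(2) by (simp add: h_def fin Max_in)
  ultimately obtain u where "u \<in> eval mset_alg \<rho> s" "f w \<le> f u"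
    by auto
  then show "\<exists>b\<in>(+) c ` eval mset_alg \<rho> s. min 3 (\<Sum>a\<in>#c + w. \<alpha> a) \<le> (\<Sum>a\<in>#b. \<alpha> a)"
    by (auto simp: f_def intro!: bexI[of _ u])
qed

text \<open>Testing whether a set contains a word supported on the letters of \<open>w\<close> is a
  homomorphism into \<open>D_alg\<close>.\<close>

lemma D_below_eval:
  fixes \<rho> :: "'v \<Rightarrow> 'c multiset set"
  assumes "satisfies D_alg (s, t)" and "\<And>v. \<rho> v \<noteq> {}" and w: "w \<in> eval mset_alg \<rho> t"
  shows "D_below ((+) c ` eval mset_alg \<rho> s) (c + w)"
proof -
  define h where "h U \<longleftrightarrow> (\<exists>u\<in>U. set_mset u \<subseteq> set_mset w)" for U
  have hom: "h (eval mset_alg \<rho> r) = eval D_alg (h \<circ> \<rho>) r" for r :: "'v ai_term"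
  proof (rule mset_alg.eval_hom)
    fix U V :: "'c multiset set"
    show "h (U +\<^bsub>mset_alg\<^esub> V) = h U +\<^bsub>D_alg\<^esub> h V"
      by (auto simp: h_def D_alg_def)
    show "h (U \<cdot>\<^bsub>mset_alg\<^esub> V) = h U \<cdot>\<^bsub>D_alg\<^esub> h V"
    proof -
      have "(\<exists>x\<in>{u + v | u v. u \<in> U \<and> v \<in> V}. set_mset x \<subseteq> set_mset w) \<longleftrightarrow>
          (\<exists>u\<in>U. \<exists>v\<in>V. set_mset (u + v) \<subseteq> set_mset w)"
        by blast
      then show ?thesis
        by (auto simp: h_def D_alg_def)
    qed
  qed (use assms in auto)
  have "eval D_alg (h \<circ> \<rho>) s = eval D_alg (h \<circ> \<rho>) t"
    using assms(1) by (auto simp: satisfies_def D_alg_def)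
  then have "h (eval mset_alg \<rho> s) = h (eval mset_alg \<rho> t)"
    by (simp only: hom)
  moreover have "h (eval mset_alg \<rho> t)"
    using w by (auto simp: h_def)
  ultimately show ?thesis
    by (auto simp: h_def D_below_def)
qed

text \<open>The common value of a set of words, or \<open>None\<close> if there is no such value, is
  a homomorphism into \<open>G_alg p\<close>: by cancellation, a product with a nonconstant factor
  is nonconstant. Cancellation also removes the context \<open>c\<close>.\<close>

lemma G_below_eval:
  fixes \<rho> :: "'v \<Rightarrow> 'c multiset set"
  assumes "satisfies (G_alg p) (s, t)" and p: "p > 0" and "\<And>v. \<rho> v \<noteq> {}"
    and w: "w \<in> eval mset_alg \<rho> t"
  shows "G_below p ((+) c ` eval mset_alg \<rho> s) (c + w)"
  unfolding G_below_def
proof (intro allI impI)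
  fix \<alpha> :: "'c \<Rightarrow> int" and g
  assume g: "\<forall>b\<in>(+) c ` eval mset_alg \<rho> s. (\<Sum>a\<in>#b. \<alpha> a) mod int p = g"
  define f where "f u = (\<Sum>a\<in>#u. \<alpha> a) mod int p" for u
  define h where "h U = (if \<exists>x. \<forall>u\<in>U. f u = x then Some (f (SOME u. u \<in> U)) else None)" for U
  have f_add: "f (u + v) = (f u + f v) mod int p" for u v
    by (simp add: f_def mod_add_eq)
  have f_range: "f u \<in> {0..<int p}" for u
    using p by (simp add: f_def)
  have h_Some: "h U = Some x \<longleftrightarrow> (\<forall>u\<in>U. f u = x)" if "U \<noteq> {}" for U x
  proof -
    have "(SOME u. u \<in> U) \<in> U"
      using that by (simp add: some_in_eq)
    then show ?thesis
      by (auto simp: h_def)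
  qed
  have h_None: "h U = None \<longleftrightarrow> (\<exists>u\<in>U. \<exists>v\<in>U. f u \<noteq> f v)" if "U \<noteq> {}" for U
    using that unfolding h_def by auto metis
  have f_cancel: "f u = f u'" if "f (u + v) = f (u' + v)" for u u' v
  proof -
    have "(f u + f v) mod int p = (f u' + f v) mod int p"
      using that by (simp add: f_add)
    then have "f u mod int p = f u' mod int p"
      by (simp add: mod_eq_dvd_iff)
    then show ?thesis
      by (simp add: f_def)
  qed
  have hom: "h (eval mset_alg \<rho> r) = eval (G_alg p) (h \<circ> \<rho>) r" for r :: "'v ai_term"
  proof (rule mset_alg.eval_hom)
    fix U V :: "'c multiset set" assume "U \<in> carrier mset_alg" "V \<in> carrier mset_alg"
    then have ne: "U \<noteq> {}" "V \<noteq> {}" "U \<union> V \<noteq> {}" "{u + v |u v. u \<in> U \<and> v \<in> V} \<noteq> {}" by auto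
    show "h (U +\<^bsub>mset_alg\<^esub> V) = h U +\<^bsub>G_alg p\<^esub> h V"
    proof (cases "h (U \<union> V)")
      case None
      have "h U \<noteq> h V \<or> h U = None"
      proof (rule ccontr)
        assume "\<not> (h U \<noteq> h V \<or> h U = None)"
        then obtain x where "h U = Some x" "h V = Some x"
          by auto
        then have "h (U \<union> V) = Some x"
          using ne by (auto simp: h_Some)
        with None show False by simp
      qed
      then show ?thesis
        using None by (auto simp: G_alg_def flat_extension_def)
    next
      case (Some x)
      then have "h U = Some x" "h V = Some x"
        using ne by (auto simp: h_Some)
      then show ?thesis
        using Some by (simp add: G_alg_def flat_extension_def)
    qed
    show "h (U \<cdot>\<^bsub>mset_alg\<^esub> V) = h U \<cdot>\<^bsub>G_alg p\<^esub> h V"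
    proof (cases "h U = None \<or> h V = None")
      case True
      have "\<exists>u\<in>{u + v |u v. u \<in> U \<and> v \<in> V}. \<exists>v\<in>{u + v |u v. u \<in> U \<and> v \<in> V}. f u \<noteq> f v"
        using True
      proof
        assume "h U = None"
        then obtain u u' where "u \<in> U" "u' \<in> U" "f u \<noteq> f u'"
          using h_None[OF ne(1)] by auto
        moreover obtain v where "v \<in> V" using ne by auto
        moreover have "f (u + v) \<noteq> f (u' + v)"
          using f_cancel calculation by blast
        ultimately show ?thesis by blast
      next
        assume "h V = None"
        then obtain v v' where "v \<in> V" "v' \<in> V" "f v \<noteq> f v'"
          using h_None[OF ne(2)] by auto
        moreover obtain u where "u \<in> U" using ne by auto
        moreover have "f (u + v) \<noteq> f (u + v')"
          using f_cancel[of v u v'] calculation by (auto simp: add.commute)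
        ultimately show ?thesis by blast
      qed
      then have "h {u + v |u v. u \<in> U \<and> v \<in> V} = None"
        using h_None[OF ne(4)] by blast
      with True show ?thesis
        by (cases "h U") (auto simp: G_alg_def flat_extension_def)
    next
      case False
      then obtain x y where xy: "h U = Some x" "h V = Some y"
        by auto
      then have "h {u + v |u v. u \<in> U \<and> v \<in> V} = Some ((x + y) mod int p)"
        using ne by (auto simp: h_Some f_add)
      with xy p show ?thesis
        by (simp add: G_alg_def flat_extension_def integer_mod_group_def)
    qed
  qed (use assms in auto)
  have "h U \<in> carrier (G_alg p)" for U
    using f_range p by (auto simp: h_def G_alg_def flat_extension_def integer_mod_group_def)
  then have "eval (G_alg p) (h \<circ> \<rho>) s = eval (G_alg p) (h \<circ> \<rho>) t"
    using assms(1) by (auto simp: satisfies_def)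
  then have eq: "h (eval mset_alg \<rho> s) = h (eval mset_alg \<rho> t)"
    by (simp only: hom)
  have ne: "eval mset_alg \<rho> s \<noteq> {}" "eval mset_alg \<rho> t \<noteq> {}"
    using mset_alg.eval_closed[of \<rho>] assms(3) by auto
  then obtain u where u: "u \<in> eval mset_alg \<rho> s" by auto
  have fg: "f (v + c) = g" if "v \<in> eval mset_alg \<rho> s" for v
    using bspec[OF g, of "c + v"] that by (simp add: f_def add.commute)
  then have "h (eval mset_alg \<rho> s) = Some (f u)"
    using ne u by (metis f_cancel h_Some)
  then have "f w = f u"
    using eq w ne by (simp add: h_Some)
  then have "f (w + c) = g"
    using fg[OF u] by (simp add: f_add)
  then show "(\<Sum>a\<in>#c + w. \<alpha> a) mod int p = g"
    by (simp add: f_def add.commute)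
qed


section \<open>The words of the identity\<close>

text \<open>\<open>P_word n\<close>, \<open>A_word\<close> and \<open>W_word n i\<close> are p_n,
  a_n and the i-th summand y_i y_{i+1} y_{i+2} x_i^2 z of f_n, up to the order of letters.\<close>

definition P_word :: "nat \<Rightarrow> sigma_var multiset" where
  "P_word n = (\<Sum>i\<in>{1..n}. {#X i, X i#})"

definition A_word :: "sigma_var multiset" where
  "A_word = {#X 1, X 1, Z#}"

definition W_word :: "nat \<Rightarrow> nat \<Rightarrow> sigma_var multiset" where
  "W_word n i = {#Y (i mod n), Y ((i + 1) mod n), Y ((i + 2) mod n), X i, X i, Z#}"

definition F_words :: "nat \<Rightarrow> sigma_var multiset set" where
  "F_words n = {P_word n, A_word} \<union> W_word n ` {1..n}"

text \<open>The candidates outside \<open>F_words n\<close> that the four semirings alone do not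
  exclude; q_n is one of them. Requiring some \<open>j\<close> in \<open>{2..n}\<close> keeps
  \<open>A_word\<close> out.\<close>

definition bad_word :: "nat \<Rightarrow> sigma_var multiset \<Rightarrow> bool" where
  "bad_word n N \<longleftrightarrow> (\<forall>r. Y r \<notin># N) \<and> count N Z = 1 \<and> (\<forall>i. count N (X i) \<in> {0, 2}) \<and>
     (\<exists>j\<in>{2..n}. X j \<in># N)"

lemma sum_mset_eq_sum_count:
  fixes \<alpha> :: "'c \<Rightarrow> 'd::comm_semiring_1"
  assumes "finite S" and "\<And>a. a \<in># N \<Longrightarrow> a \<notin> S \<Longrightarrow> \<alpha> a = 0"
  shows "(\<Sum>a\<in>#N. \<alpha> a) = (\<Sum>a\<in>S. of_nat (count N a) * \<alpha> a)"
  using assms(2)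
proof (induction N)
  case (add x N)
  have "(\<Sum>a\<in>S. of_nat (count (add_mset x N) a) * \<alpha> a) =
      (\<Sum>a\<in>S. (if a = x then \<alpha> a else 0) + of_nat (count N a) * \<alpha> a)"
    by (rule sum.cong) (auto simp: algebra_simps)
  also have "\<dots> = \<alpha> x + (\<Sum>a\<in>S. of_nat (count N a) * \<alpha> a)"
    using assms(1) add.prems[of x] by (simp add: sum.distrib)
  finally show ?case
    using add by simp
qed simp

lemma sum_mset_P_word:
  fixes \<alpha> :: "sigma_var \<Rightarrow> 'd::comm_semiring_1"
  shows "(\<Sum>a\<in>#P_word n. \<alpha> a) = 2 * (\<Sum>i\<in>{1..n}. \<alpha> (X i))"
proof -
  have "(\<Sum>a\<in>#(\<Sum>i\<in>I. {#X i, X i#}). \<alpha> a) = 2 * (\<Sum>i\<in>I. \<alpha> (X i))" if "finite I" for I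
    using that by (induction I) (simp_all add: algebra_simps mult_2)
  then show ?thesis
    by (simp add: P_word_def)
qed

lemma sum_mset_A_word: "(\<Sum>a\<in>#A_word. \<alpha> a) = \<alpha> (X 1) + (\<alpha> (X 1) + \<alpha> Z)"
  by (simp add: A_word_def)

lemma sum_mset_W_word:
  "(\<Sum>a\<in>#W_word n i. \<alpha> a) = \<alpha> (Y (i mod n)) + (\<alpha> (Y ((i + 1) mod n)) + (\<alpha> (Y ((i + 2) mod n))
     + (\<alpha> (X i) + (\<alpha> (X i) + \<alpha> Z))))"
  by (simp add: W_word_def)

lemmas sum_mset_words = sum_mset_P_word sum_mset_A_word sum_mset_W_word

lemma count_P_word:
  "count (P_word n) (X i) = (if i \<in> {1..n} then 2 else 0)"
  "count (P_word n) (Y r) = 0"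
  "count (P_word n) Z = 0"
proof -
  have "count (P_word n) (X i) = (\<Sum>j\<in>{1..n}. if j = i then 2 else 0)"
    unfolding P_word_def count_sum by (rule sum.cong) auto
  then show "count (P_word n) (X i) = (if i \<in> {1..n} then 2 else 0)"
    by simp
qed (simp_all add: P_word_def count_sum)

lemma set_P_word: "set_mset (P_word n) = X ` {1..n}"
  by (auto simp: P_word_def set_mset_sum)

text \<open>Weights up to 3 survive truncation and can be tested on a subword \<open>M\<close>
  before \<open>N\<close> is fully known.\<close>

lemma H_belowD:
  assumes "H_below B N" and "M \<subseteq># N" and "k \<le> (\<Sum>a\<in>#M. \<alpha> a)" and "k \<le> 3"
  obtains b where "b \<in> B" "(k::nat) \<le> (\<Sum>a\<in>#b. \<alpha> a)"
proof -
  obtain b where b: "b \<in> B" "min 3 (\<Sum>a\<in>#N. \<alpha> a) \<le> (\<Sum>a\<in>#b. \<alpha> a)"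
    using assms(1) unfolding H_below_def by blast
  have "(\<Sum>a\<in>#M. \<alpha> a) \<le> (\<Sum>a\<in>#N. \<alpha> a)"
    using assms(2) by (auto simp: subset_mset.le_iff_add)
  with assms b show thesis
    by (intro that[of b]) auto
qed

lemma H_below_count:
  assumes "H_below B N"
  obtains b where "b \<in> B" "min 3 (count N x) \<le> count b x"
proof -
  have "(\<Sum>a\<in>#M. if a = x then 1 else 0) = count M x" for M
    by (subst sum_mset_eq_sum_count[of "{x}"]) auto
  then show thesis
    using assms that unfolding H_below_def by metis
qed

lemma image_mset_mset_set_subseteq:
  assumes "finite T" and "inj_on f T" and "f ` T \<subseteq> set_mset N"
  shows "image_mset f (mset_set T) \<subseteq># N"
proof -
  have "image_mset f (mset_set T) = mset_set (f ` T)"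
    using assms(2) by (rule image_mset_mset_set)
  with assms show ?thesis
    by (auto simp: subseteq_mset_def count_mset_set' Suc_le_eq)
qed

section \<open>The shape of words that the four semirings place below the words of f_n\<close>

locale sigma_index =
  fixes n :: nat
  assumes n7: "n \<ge> 7" and n3: "n mod 3 = 1"
begin

lemma F_wordsE:
  assumes "b \<in> F_words n"
  obtains "b = P_word n" | "b = A_word" | i where "i \<in> {1..n}" "b = W_word n i"
  using assms by (auto simp: F_words_def)

lemma window_distinct:
  assumes "i \<in> {1..n}"
  shows "i mod n \<noteq> (i + 1) mod n" "(i + 1) mod n \<noteq> (i + 2) mod n" "i mod n \<noteq> (i + 2) mod n"
  using assms n7 by (auto simp: mod_if)

text \<open>In a window on a cycle this long, the only two residues that are two steps apart are its
  ends, and in one direction only.\<close>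

lemma window_unique:
  assumes "i \<in> {1..n}" and "j \<in> {1..n}"
    and "i mod n \<in> {j mod n, (j + 1) mod n, (j + 2) mod n}"
    and "(i + 2) mod n \<in> {j mod n, (j + 1) mod n, (j + 2) mod n}"
  shows "i = j"
  using assms n7 by (auto simp: mod_if split: if_splits)

lemma count_F_words:
  assumes "b \<in> F_words n"
  shows "count b (X i) \<in> {0, 2}" "count b (Y r) \<le> 1" "count b Z \<le> 1"
    and "i \<notin> {1..n} \<Longrightarrow> count b (X i) = 0"
  using assms n7 window_distinct
  by (auto elim!: F_wordsE simp: count_P_word A_word_def W_word_def)

text \<open>\<open>H_alg\<close> bounds each count by its maximum over \<open>F_words n\<close>,
  which is below the truncation at 3; \<open>G_alg 2\<close> makes the counts of x-letters
  even.\<close>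

lemma below_counts:
  assumes H: "H_below (F_words n) N" and G2: "G_below 2 (F_words n) N"
  shows "count N (X i) \<in> {0, 2}" "count N (Y r) \<le> 1" "count N Z \<le> 1"
    and "i \<notin> {1..n} \<Longrightarrow> count N (X i) = 0"
proof -
  have sum_count: "(\<Sum>a\<in>#M. if a = X i then 1 else 0) = int (count M (X i))" for M
    by (subst sum_mset_eq_sum_count[of "{X i}"]) auto
  have "(\<Sum>a\<in>#N. if a = X i then 1 else 0) mod int 2 = 0"
    using G2 unfolding G_below_def
  proof (elim allE impE)
    show "\<forall>b\<in>F_words n. (\<Sum>a\<in>#b. if a = X i then 1 else 0) mod int 2 = 0"
    proof
      fix b assume "b \<in> F_words n"
      from count_F_words(1)[OF this, of i] show "(\<Sum>a\<in>#b. if a = X i then 1 else 0) mod int 2 = 0"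
        by (auto simp: sum_count)
    qed
  qed
  then have "even (count N (X i))"
    by (simp add: sum_count) presburger
  moreover obtain b where "b \<in> F_words n" "min 3 (count N (X i)) \<le> count b (X i)"
    using H_below_count[OF H] .
  ultimately have even: "even (count N (X i))" and le: "min 3 (count N (X i)) \<le> count b (X i)"
    and b: "b \<in> F_words n"
    by blast+
  have "count b (X i) \<le> 2"
    using count_F_words(1)[OF b, of i] by auto
  with le even show "count N (X i) \<in> {0, 2}"
    by simp presburger
  show "count N (X i) = 0" if "i \<notin> {1..n}"
    using le count_F_words(4)[OF b that] by simp
  show "count N (Y r) \<le> 1"
  proof -
    obtain b where "b \<in> F_words n" "min 3 (count N (Y r)) \<le> count b (Y r)"
      using H_below_count[OF H] .
    then show ?thesis
      using count_F_words(2)[of b r] by linarith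
  qed
  show "count N Z \<le> 1"
  proof -
    obtain b where "b \<in> F_words n" "min 3 (count N Z) \<le> count b Z"
      using H_below_count[OF H] .
    then show ?thesis
      using count_F_words(3)[of b] by linarith
  qed
qed


text \<open>Every word of \<open>F_words n\<close> has 0 or 3 y-letters, so \<open>G_alg 3\<close>
  makes their number in \<open>N\<close> a multiple of 3. \<open>H_alg\<close> forces any three of
  them to form a window, which leaves no room for a fourth.\<close>

lemma below_Y_window:
  assumes H: "H_below (F_words n) N" and G2: "G_below 2 (F_words n) N"
    and G3: "G_below 3 (F_words n) N" and Y: "Y r \<in># N"
  obtains i where "i \<in> {1..n}"
    "\<And>k. Y k \<in># N \<longleftrightarrow> k \<in> {i mod n, (i + 1) mod n, (i + 2) mod n}"
proof -
  define T where "T = {k. Y k \<in># N}"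
  have "T = Y -` set_mset N"
    by (auto simp: T_def)
  then have "finite T"
    by (auto intro!: finite_vimageI simp: inj_def)
  have weight_Y: "(\<Sum>a\<in>#M. case a of Y k \<Rightarrow> 1 | _ \<Rightarrow> 0) mod int 3 = 0" if "M \<in> F_words n" for M
    using that by (auto elim!: F_wordsE simp: sum_mset_words)
  have "(\<Sum>a\<in>#N. case a of Y k \<Rightarrow> 1 | _ \<Rightarrow> 0) mod int 3 = 0"
    using G3 weight_Y unfolding G_below_def by blast
  moreover have "(\<Sum>a\<in>#N. case a of Y k \<Rightarrow> 1 | _ \<Rightarrow> 0) = int (card T)"
  proof -
    have "count N (Y k) = 1" if "k \<in> T" for k
      using below_counts(2)[OF H G2, of k] that count_greater_zero_iff[of N "Y k"]
      by (simp add: T_def del: count_greater_zero_iff)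
    moreover have "(\<Sum>a\<in>#N. case a of Y k \<Rightarrow> 1 | _ \<Rightarrow> 0) =
        (\<Sum>a\<in>Y ` T. int (count N a) * (case a of Y k \<Rightarrow> 1 | _ \<Rightarrow> 0))"
      using \<open>finite T\<close> by (intro sum_mset_eq_sum_count) (auto simp: T_def split: sigma_var.splits)
    ultimately show ?thesis
      by (simp add: sum.reindex inj_on_def)
  qed
  moreover have "card T > 0"
    using Y \<open>finite T\<close> by (auto simp: T_def card_gt_0_iff)
  ultimately have "int (card T) mod 3 = 0" "card T > 0"
    by simp_all
  then have "3 \<le> card T"
    by presburger
  then obtain T' where T': "T' \<subseteq> T" "card T' = 3"
    by (metis obtain_subset_with_card_n)
  \<comment> \<open>A word of \<open>F_words n\<close> must reach the weight 3 of the letters in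
    \<open>R\<close>; this takes a \<open>W_word n i\<close> whose three y-letters all lie in
    \<open>R\<close>.\<close>
  have triple: "\<exists>i\<in>{1..n}. R \<subseteq> {i mod n, (i + 1) mod n, (i + 2) mod n} \<and> {i mod n, (i + 1) mod n, (i + 2) mod n} \<subseteq> R"
    if R: "R \<subseteq> T" "card R = 3" for R
  proof -
    have "finite R"
      using R(2) card.infinite by fastforce
    define \<alpha> where "\<alpha> a = (case a of Y k \<Rightarrow> if k \<in> R then 1 else 0 | _ \<Rightarrow> (0::nat))" for a
    have "(\<Sum>a\<in>#image_mset Y (mset_set R). \<alpha> a) = (\<Sum>k\<in>R. 1)"
      unfolding image_mset.compositionality sum_unfold_sum_mset[symmetric]
      by (rule sum.cong) (auto simp: \<alpha>_def)
    moreover have "image_mset Y (mset_set R) \<subseteq># N"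
      using R \<open>finite R\<close> by (intro image_mset_mset_set_subseteq) (auto simp: T_def inj_on_def)
    ultimately obtain b where "b \<in> F_words n" "3 \<le> (\<Sum>a\<in>#b. \<alpha> a)"
      using R H_belowD[OF H, of "image_mset Y (mset_set R)" 3 \<alpha>] by auto
    then obtain i where i: "i \<in> {1..n}" "{i mod n, (i + 1) mod n, (i + 2) mod n} \<subseteq> R"
      by (auto elim!: F_wordsE simp: sum_mset_words \<alpha>_def split: if_splits)
    moreover have "card {i mod n, (i + 1) mod n, (i + 2) mod n} = 3"
      using window_distinct[OF i(1)] by (simp add: card_insert_if)
    ultimately have "{i mod n, (i + 1) mod n, (i + 2) mod n} = R"
      using \<open>finite R\<close> R by (intro card_subset_eq) auto
    with i(1) show ?thesis by blast
  qed
  obtain i where i: "i \<in> {1..n}" "{i mod n, (i + 1) mod n, (i + 2) mod n} \<subseteq> T'"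
    using triple[OF T'] by blast
  \<comment> \<open>With the two ends of the window, a fourth letter would form a triple and hence a
    window, but the ends already determine the window.\<close>
  have "k \<in> {i mod n, (i + 1) mod n, (i + 2) mod n}" if k: "k \<in> T" for k
  proof (rule ccontr)
    assume k': "\<not> ?thesis"
    have "card {i mod n, (i + 2) mod n, k} = 3"
      using k' window_distinct[OF i(1)] by (auto simp: card_insert_if)
    then obtain j where j: "j \<in> {1..n}"
      "{i mod n, (i + 2) mod n, k} \<subseteq> {j mod n, (j + 1) mod n, (j + 2) mod n}"
      using triple[of "{i mod n, (i + 2) mod n, k}"] i T' k by blast
    then have "i = j"
      using window_unique[OF i(1) j(1)] by blast
    with j k' show False by blast
  qed
  with i T' have "T = {i mod n, (i + 1) mod n, (i + 2) mod n}"
    by blast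
  then show thesis
    using that[OF i(1)] unfolding T_def by blast
qed

text \<open>If \<open>N\<close> has y-letters, their window \<open>i\<close> forces the rest to be
  x_i^2 z. Otherwise \<open>D_alg\<close> puts all letters of p_n or of a_n into \<open>N\<close>,
  and the presence of z separates p_n from products of z and squares.\<close>

lemma below_cases:
  assumes H: "H_below (F_words n) N" and D: "D_below (F_words n) N"
    and G2: "G_below 2 (F_words n) N" and G3: "G_below 3 (F_words n) N"
  shows "N \<in> F_words n \<or> bad_word n N"
proof (cases "\<exists>r. Y r \<in># N")
  case True
  then obtain i where i: "i \<in> {1..n}"
    and Y: "\<And>k. Y k \<in># N \<longleftrightarrow> k \<in> {i mod n, (i + 1) mod n, (i + 2) mod n}"
    using below_Y_window[OF H G2 G3] by blast
  have X: "count N (X j) = 0" if "j \<noteq> i" for j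
  proof (rule ccontr)
    assume *: "count N (X j) \<noteq> 0"
    then have j: "j \<in> {1..n}"
      using below_counts(4)[OF H G2, of j] by metis
    have c: "count N (X j) = 2"
      using * below_counts(1)[OF H G2, of j] by (metis insertE singletonD)
    have "\<exists>k\<in>{i mod n, (i + 1) mod n, (i + 2) mod n}. k \<notin> {j mod n, (j + 1) mod n, (j + 2) mod n}"
    proof (rule ccontr)
      assume "\<not> ?thesis"
      then have "i mod n \<in> {j mod n, (j + 1) mod n, (j + 2) mod n}"
        "(i + 2) mod n \<in> {j mod n, (j + 1) mod n, (j + 2) mod n}"
        by simp_all
      then have "i = j"
        by (rule window_unique[OF i j])
      with that show False by simp
    qed
    then obtain k where k: "k \<in> {i mod n, (i + 1) mod n, (i + 2) mod n}"
      "k \<notin> {j mod n, (j + 1) mod n, (j + 2) mod n}"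
      by blast
    \<comment> \<open>The subword x_j^2 y_k has weight 3. Among the words of
      \<open>F_words n\<close>, only \<open>W_word n j\<close> has x_j^2 together with y-letters,
      and its window omits \<open>k\<close>.\<close>
    define \<alpha> where "\<alpha> a = (if a = X j \<or> a = Y k then 1 else 0::nat)" for a
    have "{#X j, X j, Y k#} \<subseteq># N"
      using c Y[of k] k(1) by (auto simp: subseteq_mset_def Suc_le_eq)
    then obtain b where "b \<in> F_words n" "3 \<le> (\<Sum>a\<in>#b. \<alpha> a)"
      using H_belowD[OF H, of "{#X j, X j, Y k#}" 3 \<alpha>] by (auto simp: \<alpha>_def)
    then show False
    proof (cases rule: F_wordsE)
      case (3 l)
      with \<open>3 \<le> (\<Sum>a\<in>#b. \<alpha> a)\<close> k(2) window_distinct[OF 3(1)] show False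
        by (auto simp: sum_mset_words \<alpha>_def split: if_splits)
    qed (use \<open>3 \<le> (\<Sum>a\<in>#b. \<alpha> a)\<close> j in \<open>auto simp: sum_mset_words \<alpha>_def split: if_splits\<close>)
  qed
  \<comment> \<open>The number of x-letters is 2 in \<open>A_word\<close> and in each
    \<open>W_word n i\<close>, and it is 2n in \<open>P_word n\<close>, where n is 1 modulo 3. So
    \<open>N\<close> cannot be free of x-letters.\<close>
  have weight_X: "(\<Sum>a\<in>#M. case a of X k \<Rightarrow> 1 | _ \<Rightarrow> 0) mod int 3 = 2" if "M \<in> F_words n" for M
    using that n3 by (auto elim!: F_wordsE simp: sum_mset_words) presburger
  have "(\<Sum>a\<in>#N. case a of X k \<Rightarrow> 1 | _ \<Rightarrow> 0) mod int 3 = 2"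
    using G3 weight_X unfolding G_below_def by blast
  moreover have "(\<Sum>a\<in>#N. case a of X k \<Rightarrow> 1 | _ \<Rightarrow> 0) = int (count N (X i))"
    using X by (subst sum_mset_eq_sum_count[of "{X i}"])
      (auto split: sigma_var.splits simp flip: not_in_iff)
  ultimately have Xi: "count N (X i) = 2"
    using below_counts(1)[OF H G2, of i] by auto
  \<comment> \<open>This word yields z: it cannot be p_n, since \<open>N\<close> lacks x_1 or x_2,
    and all other words of \<open>F_words n\<close> contain z.\<close>
  obtain b where b: "b \<in> F_words n" "set_mset b \<subseteq> set_mset N"
    using D unfolding D_below_def by blast
  have "b \<noteq> P_word n"
  proof
    assume "b = P_word n"
    then have "X ` {1..n} \<subseteq> set_mset N"
      using b by (simp add: set_P_word)
    moreover have "1 \<in> {1..n}" "2 \<in> {1..n}" using n7 by auto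
    ultimately have "X 1 \<in># N" "X 2 \<in># N" by blast+
    then show False
      using X[of 1] X[of 2] by (cases "i = 1") (auto simp: not_in_iff[symmetric])
  qed
  with b have "Z \<in># N"
    by (auto elim!: F_wordsE simp: A_word_def W_word_def)
  then have "count N Z = 1"
    using below_counts(3)[OF H G2] count_greater_zero_iff[of N Z] by linarith
  moreover have "count N (Y k) = (if k \<in> {i mod n, (i + 1) mod n, (i + 2) mod n} then 1 else 0)" for k
    using below_counts(2)[OF H G2, of k] Y[of k] count_greater_zero_iff[of N "Y k"]
    by (auto simp del: count_greater_zero_iff)
  ultimately have "count N a = count (W_word n i) a" for a
    using X Xi window_distinct[OF i] by (cases a) (auto simp: W_word_def)
  then have "N = W_word n i"
    by (simp add: multiset_eq_iff)
  with i show ?thesis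
    by (simp add: F_words_def)
next
  case False
  then have Y: "count N (Y r) = 0" for r
    by (simp add: not_in_iff)
  obtain b where b: "b \<in> F_words n" "set_mset b \<subseteq> set_mset N"
    using D unfolding D_below_def by blast
  with False have b_cases: "b = P_word n \<or> b = A_word"
    by (auto elim!: F_wordsE simp: W_word_def)
  show ?thesis
  proof (cases "Z \<in># N")
    case True
    then have Z: "count N Z = 1"
      using below_counts(3)[OF H G2] count_greater_zero_iff[of N Z] by linarith
    show ?thesis
    proof (cases "\<exists>j\<in>{2..n}. X j \<in># N")
      case True
      then show ?thesis
        using False Z below_counts(1)[OF H G2] by (auto simp: bad_word_def)
    next
      case noX: False
      have "b \<noteq> P_word n"
        using b(2) noX n7 by (auto simp: set_P_word image_subset_iff)
      with b b_cases have "X 1 \<in># N"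
        by (simp add: A_word_def)
      then have "count N (X 1) = 2"
        using below_counts(1)[OF H G2, of 1] by (auto simp flip: not_in_iff)
      moreover have "count N (X j) = 0" if "j \<noteq> 1" for j
        using noX below_counts(4)[OF H G2, of j] that by (cases "j \<in> {1..n}") (auto simp flip: not_in_iff)
      ultimately have "count N a = count A_word a" for a
        using Y Z by (cases a) (auto simp: A_word_def)
      then show ?thesis
        by (simp add: multiset_eq_iff F_words_def)
    qed
  next
    case False
    then have "b = P_word n"
      using b b_cases by (auto simp: A_word_def)
    then have "X i \<in># N" if "i \<in> {1..n}" for i
      using that b(2) by (auto simp: set_P_word)
    then have "count N (X i) = (if i \<in> {1..n} then 2 else 0)" for i
      using below_counts(1,4)[OF H G2, of i] by (auto simp flip: not_in_iff)
    then have "count N a = count (P_word n) a" for a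
      using Y False by (cases a) (auto simp: count_P_word not_in_iff)
    then show ?thesis
      by (simp add: multiset_eq_iff F_words_def)
  qed
qed


section \<open>The exchange argument\<close>

text \<open>If a variable takes two values u and u' in one bad word, then replacing either by the
  other gives two words whose counts average to those of the bad word. The bad word attains the
  bounds 2 and 1 at all its letters, so both new words do too, and u = u'.\<close>

lemma bad_word_single_substitution:
  fixes \<rho> :: "'v \<Rightarrow> sigma_var multiset set"
  assumes X: "\<And>w i. w \<in> eval mset_alg \<rho> t \<Longrightarrow> count (c + w) (X i) \<le> 2"
    and Z: "\<And>w. w \<in> eval mset_alg \<rho> t \<Longrightarrow> count (c + w) Z \<le> 1"
    and w: "w \<in> eval mset_alg \<rho> t" and bad: "bad_word n (c + w)"
    and ne: "\<And>v. \<rho> v \<noteq> {}"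
  obtains \<psi> where "\<And>v. \<psi> v \<in> \<rho> v" "w \<in> eval mset_alg (\<lambda>v. {\<psi> v}) t"
proof -
  obtain M where M: "M \<in> eval mset_alg (\<lambda>v. (\<lambda>u. {#(v, u)#}) ` \<rho> v) t" "w = \<Sum>\<^sub># (image_mset snd M)"
    using eval_mset_alg_tagged[OF w] .
  have unique: "u = u'" if u: "(v, u) \<in># M" "(v, u') \<in># M" for v u u'
  proof (rule ccontr)
    assume "u \<noteq> u'"
    with u have "(v, u') \<in># M - {#(v, u)#}"
      by (simp add: in_diff_count)
    then obtain M0 where "M - {#(v, u)#} = add_mset (v, u') M0"
      by (metis insert_DiffM)
    then have M0: "M = {#(v, u), (v, u')#} + M0"
      using insert_DiffM[OF u(1)] by simp
    have exchange: "x + x + \<Sum>\<^sub># (image_mset snd M0) \<in> eval mset_alg \<rho> t"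
      if x: "x \<in> {u, u'}" "y \<in> {u, u'}" "x \<noteq> y" for x y
    proof -
      have "add_mset (v, x) (M - {#(v, y)#}) \<in> eval mset_alg (\<lambda>v. (\<lambda>u. {#(v, u)#}) ` \<rho> v) t"
        using u x eval_mset_alg_tag_mem[OF M(1)] by (intro eval_mset_alg_exchange[OF M(1)]) auto
      moreover have "add_mset (v, x) (M - {#(v, y)#}) = {#(v, x), (v, x)#} + M0"
        using x by (auto simp: M0)
      ultimately have N: "{#(v, x), (v, x)#} + M0 \<in> eval mset_alg (\<lambda>v. (\<lambda>u. {#(v, u)#}) ` \<rho> v) t"
        by simp
      have "\<Sum>\<^sub># (image_mset snd ({#(v, x), (v, x)#} + M0)) \<in> eval mset_alg \<rho> t"
        using eval_mset_alg_untag[OF N eval_mset_alg_tag_mem[OF N]] .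
      then show ?thesis
        by (simp add: add.assoc)
    qed
    define C where "C a = count (c + \<Sum>\<^sub># (image_mset snd M0)) a" for a
    have N: "count (c + w) a = C a + count u a + count u' a" for a
      by (simp add: C_def M(2) M0)
    have uu: "count (c + (u + u + \<Sum>\<^sub># (image_mset snd M0))) a = C a + 2 * count u a"
      and uu': "count (c + (u' + u' + \<Sum>\<^sub># (image_mset snd M0))) a = C a + 2 * count u' a" for a
      by (simp_all add: C_def)
    have mem: "u + u + \<Sum>\<^sub># (image_mset snd M0) \<in> eval mset_alg \<rho> t"
      "u' + u' + \<Sum>\<^sub># (image_mset snd M0) \<in> eval mset_alg \<rho> t"
      using exchange[of u u'] exchange[of u' u] \<open>u \<noteq> u'\<close> by auto
    \<comment> \<open>The counts C + 2u and C + 2u' are bounded, and their sum is twice C + u + u'.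
      If the latter attains the bound, both are equal to it; if it is 0, everything
      vanishes.\<close>
    have "count u a = count u' a" for a
    proof (cases a)
      case (X i)
      have "C a + 2 * count u a \<le> 2" "C a + 2 * count u' a \<le> 2"
        using X assms(1)[OF mem(1), of i] assms(1)[OF mem(2), of i] by (simp_all only: uu uu')
      moreover have "count (c + w) (X i) \<in> {0, 2}"
        using bad unfolding bad_word_def by blast
      then have "C a + count u a + count u' a \<in> {0, 2}"
        using X by (simp only: N)
      ultimately show ?thesis by auto
    next
      case (Y r)
      have "count (c + w) a = 0"
        using bad Y unfolding bad_word_def by (auto simp only: not_in_iff)
      then show ?thesis by (simp only: N)
    next
      case Z
      have "C a + 2 * count u a \<le> 1" "C a + 2 * count u' a \<le> 1"
        using Z assms(2)[OF mem(1)] assms(2)[OF mem(2)] by (simp_all only: uu uu')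
      moreover have "count (c + w) Z = 1"
        using bad unfolding bad_word_def by blast
      then have "C a + count u a + count u' a = 1"
        using Z by (simp only: N)
      ultimately show ?thesis by auto
    qed
    then show False
      using \<open>u \<noteq> u'\<close> by (simp add: multiset_eq_iff)
  qed
  \<comment> \<open>A variable that is not recorded in \<open>M\<close> gets an arbitrary value from
    \<open>\<rho> v\<close>.\<close>
  define \<psi> where "\<psi> v = (if \<exists>u. (v, u) \<in># M then SOME u. (v, u) \<in># M else SOME u. u \<in> \<rho> v)" for v
  have \<psi>: "u = \<psi> v" if "(v, u) \<in># M" for v u
  proof -
    have "(v, \<psi> v) \<in># M"
      using that someI[of "\<lambda>u. (v, u) \<in># M"] by (auto simp: \<psi>_def)
    with that show ?thesis by (rule unique)
  qed
  show thesis
  proof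
    show "\<psi> v \<in> \<rho> v" for v
    proof (cases "\<exists>u. (v, u) \<in># M")
      case True
      then obtain u where "(v, u) \<in># M" by blast
      with \<psi> show ?thesis
        using eval_mset_alg_tag_mem[OF M(1)] by blast
    next
      case False
      with ne[of v] show ?thesis
        by (simp add: \<psi>_def some_in_eq)
    qed
    show "w \<in> eval mset_alg (\<lambda>v. {\<psi> v}) t"
      unfolding M(2) using M(1) \<psi> by (intro eval_mset_alg_untag) auto
  qed
qed

section \<open>A missing summand and separating weights modulo 3\<close>

text \<open>The letter x_i occurs in \<open>W_word n i\<close> but in no other
  \<open>W_word n j\<close>. If all these words were present, each x_i would be contributed by a
  variable of \<open>s\<close> of its own, which needs \<open>n\<close> variables.\<close>

lemma W_word_missing:
  assumes "card (vars s) < n"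
  shows "\<exists>m\<in>{1..n}. W_word n m \<notin> (+) c ` eval mset_alg (\<lambda>v. {\<psi> v}) s"
proof (rule ccontr)
  assume "\<not> ?thesis"
  then have all: "W_word n i \<in> (+) c ` eval mset_alg (\<lambda>v. {\<psi> v}) s" if "i \<in> {1..n}" for i
    using that by blast
  have X_W: "X l \<in># W_word n i \<longleftrightarrow> l = i" for l i
    by (auto simp: W_word_def)
  \<comment> \<open>A letter of the context would occur in every \<open>W_word n i\<close>.\<close>
  have "X l \<notin># c" for l
  proof
    assume "X l \<in># c"
    then have "l = i" if "i \<in> {1..n}" for i
      using all[OF that] X_W[of l i] by auto
    from this[of 1] this[of 2] show False
      using n7 by simp
  qed
  have "\<exists>v \<in> vars s. X i \<in># \<psi> v \<and> \<psi> v \<subseteq># W_word n i" if i: "i \<in> {1..n}" for i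
  proof -
    obtain u where u: "u \<in> eval mset_alg (\<lambda>v. {\<psi> v}) s" "W_word n i = c + u"
      using all[OF i] by auto
    have "X i \<in># c + u"
      using X_W[of i i] u(2) by simp
    with \<open>\<And>l. X l \<notin># c\<close> have "X i \<in># u"
      by auto
    then obtain v where "v \<in> vars s" "X i \<in># \<psi> v" "\<psi> v \<subseteq># u"
      using eval_mset_alg_var_mem[OF u(1)] by blast
    with u(2) show ?thesis
      by (metis mset_subset_eq_add_right subset_mset.order_trans)
  qed
  then obtain f where f: "\<And>i. i \<in> {1..n} \<Longrightarrow> f i \<in> vars s"
    "\<And>i. i \<in> {1..n} \<Longrightarrow> X i \<in># \<psi> (f i)" "\<And>i. i \<in> {1..n} \<Longrightarrow> \<psi> (f i) \<subseteq># W_word n i"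
    by metis
  have "inj_on f {1..n}"
  proof (rule inj_onI)
    fix i j assume "i \<in> {1..n}" "j \<in> {1..n}" "f i = f j"
    then show "i = j"
      using f(2)[of i] f(3)[of j] X_W[of i j] by (metis mset_subset_eqD)
  qed
  moreover have "finite (vars s)"
    by (induction s) auto
  ultimately have "card {1..n} \<le> card (vars s)"
    using f(1) by (intro card_inj_on_le[of f]) auto
  with assms show False by simp
qed

text \<open>Modulo 3 the windows act on the cyclic sequence \<open>y\<close> by \<open>1 + t + t\<^sup>2 = (t - 1)\<^sup>2\<close>. Hence \<open>y\<close> is
  obtained by summing twice: the first sum is the indicator function of \<open>{a<..b}\<close>, shifted by the
  constant \<open>- (b - a)\<close> that makes the second sum periodic because \<open>n \<equiv> 1\<close>.\<close>

lemma window_weights: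
  assumes "1 \<le> a" and "a < b" and "b \<le> n"
  obtains y :: "nat \<Rightarrow> int" where
    "\<And>i. i \<in> {1..n} \<Longrightarrow> (y (i mod n) + y ((i + 1) mod n) + y ((i + 2) mod n)) mod 3 =
       ((if i = a then 1 else 0) - (if i = b then 1 else 0)) mod 3"
proof -
  define l where "l = int b - int a"
  \<comment> \<open>\<open>C k\<close> counts the elements of \<open>{a<..b}\<close> below
    \<open>k\<close>, so it is the running sum of the indicator function.\<close>
  define C where "C k = max 0 (min (int k - 1) (int b) - int a)" for k
  define y where "y r = C (if r = 0 then n else r) - l * int (if r = 0 then n else r)" for r
  define q where "q = n div 3"
  have nq: "int n = 3 * int q + 1"
    using n3 unfolding q_def by presburger
  \<comment> \<open>The residue 0 stands for \<open>n\<close>, so only \<open>k = n + 1\<close> and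
    \<open>k = n + 2\<close> wrap around. There \<open>C k - l * int k\<close> differs from its
    value one period earlier by l - l n = -3 l q.\<close>
  have periodic: "3 dvd y (k mod n) - (C k - l * int k)" if "1 \<le> k" "k \<le> n + 2" for k
  proof -
    have "k < n \<or> k = n \<or> k = n + 1 \<or> k = n + 2"
      using that by linarith
    then consider "k < n" | "k = n" | "k = n + 1" | "k = n + 2"
      by blast
    then show ?thesis
    proof cases
      case 3
      then have "k mod n = 1"
        using n7 by (simp add: mod_if)
      moreover have "y 1 = - l"
        using assms by (simp add: y_def C_def)
      moreover have "C k = l"
        using 3 assms by (simp add: C_def l_def)
      ultimately have "y (k mod n) - (C k - l * int k) = 3 * (l * int q)"
        using 3 nq by (simp add: algebra_simps)
      then show ?thesis by (metis dvd_triv_left)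
    next
      case 4
      then have "k mod n = 2"
        using n7 by (simp add: mod_if)
      moreover have "y 2 = - (2 * l)"
        using assms by (simp add: y_def C_def)
      moreover have "C k = l"
        using 4 assms by (simp add: C_def l_def)
      ultimately have "y (k mod n) - (C k - l * int k) = 3 * (l * int q)"
        using 4 nq by (simp add: algebra_simps)
      then show ?thesis by (metis dvd_triv_left)
    qed (use that in \<open>simp_all add: y_def\<close>)
  qed
  show thesis
  proof (rule that[of y])
    fix i assume i: "i \<in> {1..n}"
    define d :: int where "d = (if i = a then 1 else 0) - (if i = b then 1 else 0)"
    define e :: int where "e = (if a < i \<and> i \<le> b then 1 else 0)"
    have "C (i + 1) - C i = (if a < i \<and> i \<le> b then 1 else 0)"
      "C (i + 2) - C (i + 1) = (if a < i + 1 \<and> i + 1 \<le> b then 1 else 0)"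
      using assms by (auto simp: C_def)
    \<comment> \<open>The increments of \<open>C\<close> at \<open>i\<close> and
      \<open>i + 1\<close> are the indicators of \<open>{a<..b}\<close> there, which differ by
      \<open>d\<close>.\<close>
    then have C: "C i + C (i + 1) + C (i + 2) = 3 * C i + 3 * e + d"
      using assms(2) unfolding d_def e_def
      by (cases "i = a"; cases "i = b"; cases "a < i"; cases "i < b") auto
    have y: "3 dvd y (i mod n) - (C i - l * int i)"
      "3 dvd y ((i + 1) mod n) - (C (i + 1) - l * int (i + 1))"
      "3 dvd y ((i + 2) mod n) - (C (i + 2) - l * int (i + 2))"
      using i by (intro periodic; simp)+
    have "3 dvd (y (i mod n) - (C i - l * int i)) + (y ((i + 1) mod n) - (C (i + 1) - l * int (i + 1)))
        + (y ((i + 2) mod n) - (C (i + 2) - l * int (i + 2))) + 3 * (C i + e - l * (int i + 1))"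
      using y by (intro dvd_add) simp_all
    also have "\<dots> = y (i mod n) + y ((i + 1) mod n) + y ((i + 2) mod n) - (C i + C (i + 1) + C (i + 2))
        + 3 * (C i + e)"
      by (simp add: algebra_simps)
    also have "\<dots> = y (i mod n) + y ((i + 1) mod n) + y ((i + 2) mod n) - d"
      by (simp only: C) (simp add: algebra_simps)
    finally show "(y (i mod n) + y ((i + 1) mod n) + y ((i + 2) mod n)) mod 3 =
        ((if i = a then 1 else 0) - (if i = b then 1 else 0)) mod 3"
      unfolding d_def[symmetric] by (simp add: mod_eq_dvd_iff)
  qed
qed

text \<open>Each residue lies in three windows, so all window sums together give 0 modulo 3. A
  single 1 at \<open>j\<close> is possible because the exempted window \<open>m\<close> takes the
  compensating -1.\<close>

lemma window_weights_single:
  assumes "j \<in> {1..n}" and "m \<in> {1..n}"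
  obtains y :: "nat \<Rightarrow> int" where
    "\<And>i. i \<in> {1..n} \<Longrightarrow> i \<noteq> m \<Longrightarrow>
       (y (i mod n) + y ((i + 1) mod n) + y ((i + 2) mod n)) mod 3 = (if i = j then 1 else 0)"
proof -
  consider "j = m" | "j < m" | "m < j" by linarith
  then show thesis
  proof cases
    case 1
    then show thesis by (intro that[of "\<lambda>_. 0"]) auto
  next
    case 2
    then obtain y :: "nat \<Rightarrow> int" where "\<And>i. i \<in> {1..n} \<Longrightarrow>
       (y (i mod n) + y ((i + 1) mod n) + y ((i + 2) mod n)) mod 3 =
       ((if i = j then 1 else 0) - (if i = m then 1 else 0)) mod 3"
      using window_weights[of j m] assms by auto
    then show thesis by (intro that[of y]) auto
  next
    case 3
    then obtain y :: "nat \<Rightarrow> int" where y: "\<And>i. i \<in> {1..n} \<Longrightarrow>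
       (y (i mod n) + y ((i + 1) mod n) + y ((i + 2) mod n)) mod 3 =
       ((if i = m then 1 else 0) - (if i = j then 1 else 0)) mod 3"
      using window_weights[of m j] assms by auto
    show thesis
    \<comment> \<open>\<open>window_weights\<close> puts the value 1 at the smaller index, here
      \<open>m\<close>, so the sign is reversed.\<close>
    proof (rule that[of "\<lambda>r. - y r"])
      fix i assume "i \<in> {1..n}" "i \<noteq> m"
      with y[of i] show "(- y (i mod n) + - y ((i + 1) mod n) + - y ((i + 2) mod n)) mod 3 = (if i = j then 1 else 0)"
        by (auto split: if_splits) presburger+
    qed
  qed
qed

text \<open>Give x_j weight 1, z weight 2 and the y-letters weights whose window sum is 1 at
  \<open>j\<close> and 0 at every other window except possibly \<open>m\<close>. All words of
  \<open>B\<close> then weigh 2 modulo 3: for \<open>W_word n j\<close> the window and x_j^2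
  together add 3. But \<open>N\<close> weighs 2 + 2, which is 1.\<close>

lemma bad_word_not_G_below:
  assumes bad: "bad_word n N" and B: "B \<subseteq> F_words n" and m: "m \<in> {1..n}" "W_word n m \<notin> B"
  shows "\<not> G_below 3 B N"
proof
  assume G: "G_below 3 B N"
  obtain j where j: "j \<in> {2..n}" "X j \<in># N"
    using bad unfolding bad_word_def by blast
  then have "j \<in> {1..n}" "j \<noteq> 1" by auto
  obtain y :: "nat \<Rightarrow> int" where y: "\<And>i. i \<in> {1..n} \<Longrightarrow> i \<noteq> m \<Longrightarrow>
       (y (i mod n) + y ((i + 1) mod n) + y ((i + 2) mod n)) mod 3 = (if i = j then 1 else 0)"
    using window_weights_single[OF \<open>j \<in> {1..n}\<close> m(1)] by blast
  define \<alpha> where "\<alpha> a = (case a of X k \<Rightarrow> if k = j then 1 else 0 | Y r \<Rightarrow> y r | Z \<Rightarrow> 2)" for a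
  have "(\<Sum>a\<in>#b. \<alpha> a) mod int 3 = 2" if "b \<in> B" for b
  proof -
    have "b \<in> F_words n" using that B by blast
    then show ?thesis
    proof (cases rule: F_wordsE)
      case 1
      then show ?thesis
        using \<open>j \<in> {1..n}\<close> by (simp add: sum_mset_words \<alpha>_def)
    next
      case 2
      then show ?thesis
        using \<open>j \<noteq> 1\<close> by (simp add: sum_mset_words \<alpha>_def)
    next
      case (3 i)
      then have "i \<noteq> m" using that m(2) by blast
      from y[OF 3(1) this] show ?thesis
        by (simp add: 3(2) sum_mset_words \<alpha>_def split: if_splits) presburger+
    qed
  qed
  then have "(\<Sum>a\<in>#N. \<alpha> a) mod int 3 = 2"
    using G unfolding G_below_def by blast
  moreover have "(\<Sum>a\<in>#N. \<alpha> a) = (\<Sum>a\<in>{X j, Z}. int (count N a) * \<alpha> a)"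
    using bad by (intro sum_mset_eq_sum_count) (auto simp: \<alpha>_def bad_word_def split: sigma_var.splits)
  moreover have "count N (X j) = 2"
    using bad j(2) unfolding bad_word_def by (metis count_eq_zero_iff insertE singletonD)
  moreover have "count N Z = 1"
    using bad by (simp add: bad_word_def)
  ultimately show False
    by (simp add: \<alpha>_def)
qed


section \<open>Identities in fewer than n variables preserve the words of f_n\<close>

lemma eval_subset_F_words:
  fixes \<rho> :: "'v \<Rightarrow> sigma_var multiset set"
  assumes H: "satisfies H_alg (s, t)" and D: "satisfies D_alg (s, t)"
    and G2: "satisfies (G_alg 2) (s, t)" and G3: "satisfies (G_alg 3) (s, t)"
    and card: "card (vars s) < n"
    and ne: "\<And>v. \<rho> v \<noteq> {}" and s: "(+) c ` eval mset_alg \<rho> s \<subseteq> F_words n"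
  shows "(+) c ` eval mset_alg \<rho> t \<subseteq> F_words n"
proof -
  have below: "H_below (F_words n) (c + w)" "D_below (F_words n) (c + w)"
    "G_below 2 (F_words n) (c + w)" "G_below 3 (F_words n) (c + w)"
    if "w \<in> eval mset_alg \<rho> t" for w
  proof -
    show "H_below (F_words n) (c + w)"
      using H_below_eval[OF H ne that, of c] s unfolding H_below_def by blast
    show "D_below (F_words n) (c + w)"
      using D_below_eval[OF D ne that, of c] s unfolding D_below_def by blast
    show "G_below 2 (F_words n) (c + w)"
      by (rule G_below_mono[OF G_below_eval[OF G2 _ ne that] s]) simp
    show "G_below 3 (F_words n) (c + w)"
      by (rule G_below_mono[OF G_below_eval[OF G3 _ ne that] s]) simp
  qed
  have "c + w \<in> F_words n" if w: "w \<in> eval mset_alg \<rho> t" for w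
  proof (rule ccontr)
    assume "c + w \<notin> F_words n"
    then have bad: "bad_word n (c + w)"
      using below_cases[OF below[OF w]] by blast
    obtain \<psi> where \<psi>: "\<And>v. \<psi> v \<in> \<rho> v" "w \<in> eval mset_alg (\<lambda>v. {\<psi> v}) t"
    proof (rule bad_word_single_substitution[OF _ _ w bad ne])
      show "count (c + w') (X i) \<le> 2" if "w' \<in> eval mset_alg \<rho> t" for w' i
        using below_counts(1)[OF below(1,3)[OF that], of i] by (metis insertE le_refl singletonD zero_le)
      show "count (c + w') Z \<le> 1" if "w' \<in> eval mset_alg \<rho> t" for w'
        using below_counts(3)[OF below(1,3)[OF that]] .
    qed blast
    obtain m where m: "m \<in> {1..n}" "W_word n m \<notin> (+) c ` eval mset_alg (\<lambda>v. {\<psi> v}) s"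
      using W_word_missing[OF card] by blast
    have "eval mset_alg (\<lambda>v. {\<psi> v}) s \<subseteq> eval mset_alg \<rho> s"
      using \<psi>(1) by (intro eval_mset_alg_mono) simp
    then have "(+) c ` eval mset_alg (\<lambda>v. {\<psi> v}) s \<subseteq> F_words n"
      using s by blast
    \<comment> \<open>The identity is used in \<open>G_alg 3\<close> once more, now under
      \<open>\<psi>\<close>, where the left side lacks \<open>W_word n m\<close>.\<close>
    then show False
      using bad_word_not_G_below[OF bad _ m] G_below_eval[OF G3 _ _ \<psi>(2), of c] by simp
  qed
  then show ?thesis by blast
qed

section \<open>The syntactic semiring of the words of f_n, in which \<open>sigma n\<close>
  fails\<close>

lemma eval_f_t: "eval mset_alg (\<lambda>v. {{#v#}}) (f_t n) = F_words n"
  and eval_q_t: "eval mset_alg (\<lambda>v. {{#v#}}) (q_t n) = {add_mset Z (P_word n)}"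
proof -
  have "mset (concat (map (\<lambda>i. [X i, X i]) [1..<k + 1])) = P_word k" for k
    by (induction k) (auto simp: P_word_def)
  moreover have "p_t n = prod_terms (map Var (concat (map (\<lambda>i. [X i, X i]) [1..<n + 1])))"
    by (simp add: p_t_def x_t_def map_concat comp_def)
  moreover have "concat (map (\<lambda>i. [X i, X i]) [1..<n + 1]) \<noteq> []"
    using n7 by auto
  ultimately have P: "eval mset_alg (\<lambda>v. {{#v#}}) (p_t n) = {P_word n}"
    by (metis eval_mset_alg_prod_terms)
  then show "eval mset_alg (\<lambda>v. {{#v#}}) (q_t n) = {add_mset Z (P_word n)}"
    by (simp add: q_t_def z_t_def)
  have A: "eval mset_alg (\<lambda>v. {{#v#}}) a_t = {A_word}"
    using eval_mset_alg_prod_terms[of "[X 1, X 1, Z]"] by (simp add: a_t_def x_t_def z_t_def A_word_def)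
  have W: "eval mset_alg (\<lambda>v. {{#v#}}) (prod_terms [y_t n i, y_t n (i+1), y_t n (i+2), x_t i, x_t i, z_t])
      = {W_word n i}" for i
    using eval_mset_alg_prod_terms[of "[Y (i mod n), Y ((i + 1) mod n), Y ((i + 2) mod n), X i, X i, Z]"]
    by (simp add: y_t_def x_t_def z_t_def W_word_def)
  have "eval mset_alg (\<lambda>v. {{#v#}}) (sum_terms (map (\<lambda>i. prod_terms
        [y_t n i, y_t n (i+1), y_t n (i+2), x_t i, x_t i, z_t]) [1..<n+1])) = W_word n ` {1..n}"
    using n7 W by (subst eval_mset_alg_sum_terms) (auto simp: atLeastLessThanSuc_atLeastAtMost simp del: upt_Suc)
  with P A show "eval mset_alg (\<lambda>v. {{#v#}}) (f_t n) = F_words n"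
    by (auto simp: f_t_def F_words_def)
qed

text \<open>Equality of \<open>contexts\<close> is the syntactic congruence of
  \<open>F_words n\<close>. As words commute, a context is a single multiset.\<close>

definition contexts :: "sigma_var multiset set \<Rightarrow> sigma_var multiset set" where
  "contexts U = {c. (+) c ` U \<subseteq> F_words n}"

text \<open>A context of a nonempty set is a subword of one of the finitely many words in
  \<open>F_words n\<close>.\<close>

lemma finite_contexts: "finite (contexts ` {U. U \<noteq> {}})"
proof -
  have fin: "finite {c. c \<subseteq># b}" for b :: "sigma_var multiset"
  proof (induction b)
    case (add x b)
    have "{c. c \<subseteq># add_mset x b} \<subseteq> {c. c \<subseteq># b} \<union> add_mset x ` {c. c \<subseteq># b}"
    proof
      fix c assume c: "c \<in> {c. c \<subseteq># add_mset x b}"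
      show "c \<in> {c. c \<subseteq># b} \<union> add_mset x ` {c. c \<subseteq># b}"
      proof (cases "x \<in># c")
        case True
        then obtain c' where "c = add_mset x c'"
          by (metis insert_DiffM)
        with c show ?thesis by auto
      next
        case False
        with c have "count c a \<le> count b a" for a
          by (cases "a = x") (auto simp: subseteq_mset_def not_in_iff dest: spec[of _ a])
        then show ?thesis
          by (simp add: subseteq_mset_def)
      qed
    qed
    with add show ?case
      by (metis finite_UnI finite_imageI finite_subset)
  qed simp
  have "contexts U \<subseteq> (\<Union>b\<in>F_words n. {c. c \<subseteq># b})" if "U \<noteq> {}" for U
    using that by (auto simp: contexts_def image_subset_iff intro!: mset_subset_eq_add_left)
  then have "contexts ` {U. U \<noteq> {}} \<subseteq> Pow (\<Union>b\<in>F_words n. {c. c \<subseteq># b})"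
    by auto
  moreover have "finite (F_words n)"
    by (simp add: F_words_def)
  ultimately show ?thesis
    using fin by (metis (no_types, lifting) finite_Pow_iff finite_UN_I finite_subset)
qed

text \<open>Unions turn into intersections of contexts. The contexts of a product depend on either
  factor only through its contexts, so the factors are replaced one at a time. The injection
  \<open>g\<close> only renames the classes.\<close>

lemma ai_congruence_contexts:
  assumes inj: "inj_on g (contexts ` {U. U \<noteq> {}})"
  shows "ai_congruence mset_alg (g \<circ> contexts)"
proof
  fix U U' V V' :: "sigma_var multiset set"
  assume mem: "U \<in> carrier mset_alg" "U' \<in> carrier mset_alg" "V \<in> carrier mset_alg" "V' \<in> carrier mset_alg"
    and eq: "(g \<circ> contexts) U = (g \<circ> contexts) U'" "(g \<circ> contexts) V = (g \<circ> contexts) V'"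
  have UV: "contexts U = contexts U'" "contexts V = contexts V'"
    using inj mem eq by (auto simp: inj_on_def)
  have "contexts (U \<union> V) = contexts U \<inter> contexts V" for U V
    by (auto simp: contexts_def)
  then show "(g \<circ> contexts) (U +\<^bsub>mset_alg\<^esub> V) = (g \<circ> contexts) (U' +\<^bsub>mset_alg\<^esub> V')"
    by (simp add: UV)
  have left: "contexts {u + v |u v. u \<in> U \<and> v \<in> V} = {c. \<forall>v\<in>V. c + v \<in> contexts U}"
    and right: "contexts {u + v |u v. u \<in> U \<and> v \<in> V} = {c. \<forall>u\<in>U. c + u \<in> contexts V}" for U V
    by (auto simp: contexts_def image_subset_iff add.assoc) (metis add.commute add.left_commute)+
  have "contexts {u + v |u v. u \<in> U \<and> v \<in> V} = contexts {u + v |u v. u \<in> U' \<and> v \<in> V}"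
    by (simp only: left UV)
  also have "\<dots> = contexts {u + v |u v. u \<in> U' \<and> v \<in> V'}"
    by (simp only: right UV)
  finally have "contexts {u + v |u v. u \<in> U \<and> v \<in> V} = contexts {u + v |u v. u \<in> U' \<and> v \<in> V'}" .
  then show "(g \<circ> contexts) (U \<cdot>\<^bsub>mset_alg\<^esub> V) = (g \<circ> contexts) (U' \<cdot>\<^bsub>mset_alg\<^esub> V')"
    by simp
qed

lemma model_not_sigma:
  fixes \<Sigma> :: "nat identity set"
  assumes "infinite (UNIV :: 'a set)"
    and \<Sigma>: "\<And>e. e \<in> \<Sigma> \<Longrightarrow> satisfies H_alg e \<and> satisfies D_alg e \<and> satisfies (G_alg 2) e \<and> satisfies (G_alg 3) e"
    and card: "\<And>e. e \<in> \<Sigma> \<Longrightarrow> card (id_vars e) < n"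
  obtains S :: "'a ai_alg" where "S \<in> models \<Sigma>" "\<not> satisfies S (sigma n)"
proof -
  \<comment> \<open>The quotient is finite, so the infinite type has room for a copy of it.\<close>
  obtain R :: "'a set" where "finite R" "card R = card (contexts ` {U. U \<noteq> {}})"
    using infinite_arbitrarily_large[OF assms(1)] by blast
  then obtain g where "bij_betw g (contexts ` {U. U \<noteq> {}}) R"
    using finite_same_card_bij[OF finite_contexts] by metis
  then have inj: "inj_on g (contexts ` {U. U \<noteq> {}})"
    by (rule bij_betw_imp_inj_on)
  interpret cong: ai_congruence mset_alg "g \<circ> contexts"
    using inj by (rule ai_congruence_contexts)
  let ?S = "image_alg (g \<circ> contexts) mset_alg"
  have eq_iff: "(g \<circ> contexts) U = (g \<circ> contexts) V \<longleftrightarrow> contexts U = contexts V"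
    if "U \<in> carrier mset_alg" "V \<in> carrier mset_alg" for U V
    using that inj by (auto simp: inj_on_def)
  have "satisfies ?S e" if e: "e \<in> \<Sigma>" for e
    unfolding cong.satisfies_image_alg_iff
  proof (intro allI impI)
    fix \<rho> :: "nat \<Rightarrow> sigma_var multiset set"
    assume "\<forall>v. \<rho> v \<in> carrier mset_alg"
    then have ne: "\<And>v. \<rho> v \<noteq> {}" by simp
    obtain s t where st: "e = (s, t)" by force
    have "finite (vars r)" for r :: "nat ai_term"
      by (induction r) auto
    then have "card (vars s) < n" "card (vars t) < n"
      using card[OF e] card_mono[of "id_vars e"] by (fastforce simp: id_vars_def st)+
    \<comment> \<open>Stated for arbitrary \<open>s\<close> and \<open>t\<close>, so that it serves
      both directions of the identity.\<close>
    moreover have "contexts (eval mset_alg \<rho> s) \<subseteq> contexts (eval mset_alg \<rho> t)"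
      if "satisfies H_alg (s, t)" "satisfies D_alg (s, t)" "satisfies (G_alg 2) (s, t)"
        "satisfies (G_alg 3) (s, t)" "card (vars s) < n" for s t
    proof
      fix c assume "c \<in> contexts (eval mset_alg \<rho> s)"
      then show "c \<in> contexts (eval mset_alg \<rho> t)"
        unfolding contexts_def mem_Collect_eq by (rule eval_subset_F_words[OF that ne])
    qed
    ultimately have "contexts (eval mset_alg \<rho> s) \<subseteq> contexts (eval mset_alg \<rho> t)"
      "contexts (eval mset_alg \<rho> t) \<subseteq> contexts (eval mset_alg \<rho> s)"
      using \<Sigma>[OF e] unfolding st by (blast intro: satisfies_sym)+
    then have "contexts (eval mset_alg \<rho> s) = contexts (eval mset_alg \<rho> t)"
      by (rule subset_antisym)
    then show "(g \<circ> contexts) (eval mset_alg \<rho> (fst e)) = (g \<circ> contexts) (eval mset_alg \<rho> (snd e))"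
      by (simp add: st)
  qed
  then have "?S \<in> models \<Sigma>"
    by (simp add: models_def cong.ai_algebra_image_alg)
  moreover have "\<not> satisfies ?S (sigma n)"
  proof
    assume "satisfies ?S (sigma n)"
    then have "(g \<circ> contexts) (eval mset_alg (\<lambda>v. {{#v#}}) (fst (sigma n))) =
        (g \<circ> contexts) (eval mset_alg (\<lambda>v. {{#v#}}) (snd (sigma n)))"
      unfolding cong.satisfies_image_alg_iff by auto
    then have "contexts (F_words n \<union> {add_mset Z (P_word n)}) = contexts (F_words n)"
      by (subst (asm) eq_iff) (auto simp: sigma_def preceq_def eval_f_t eval_q_t F_words_def)
    \<comment> \<open>The empty context separates the two sides, because q_n is not in
      \<open>F_words n\<close>.\<close>
    moreover have "{#} \<in> contexts (F_words n)"
      by (simp add: contexts_def)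
    ultimately have "{#} \<in> contexts (F_words n \<union> {add_mset Z (P_word n)})"
      by simp
    then have "add_mset Z (P_word n) \<in> F_words n"
      by (simp add: contexts_def)
    then show False
    proof (cases rule: F_wordsE)
      case 1
      have "Z \<notin># P_word n"
        by (auto simp: set_P_word)
      with 1 show False
        by (metis union_single_eq_member)
    next
      case 2
      have "X 2 \<in># P_word n"
        using n7 by (simp add: set_P_word)
      then have "X 2 \<in># A_word"
        by (simp flip: 2)
      then show False
        by (simp add: A_word_def)
    next
      case (3 i)
      have "X 2 \<in># P_word n" "X 3 \<in># P_word n"
        using n7 by (simp_all add: set_P_word)
      then have "X 2 \<in># W_word n i" "X 3 \<in># W_word n i"
        by (simp_all flip: 3(2))
      then show False
        by (auto simp: W_word_def)
    qed
  qed
  ultimately show thesis using that by blast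
qed

end

section \<open>Absence of a basis in boundedly many variables\<close>

theorem theorem3p1:
  fixes V :: "'a ai_alg set"
  assumes "infinite (UNIV :: 'a set)"
    and "ai_semiring_variety V"
    and "variety_contains V H_alg"
    and "variety_contains V D_alg"
    and "variety_contains V (G_alg 2)"
    and "variety_contains V (G_alg 3)"
    and "infinite {n \<in> index_set. variety_satisfies V (sigma n)}"
  shows "\<not> bounded_variable_basis V \<and> nonfinitely_based V"
proof -
  have unbounded: "\<not> bounded_variable_basis V"
  proof
    assume "bounded_variable_basis V"
    then obtain k \<Sigma> where k: "\<And>e. e \<in> \<Sigma> \<Longrightarrow> card (id_vars e) \<le> k" and V: "V = models \<Sigma>"
      unfolding bounded_variable_basis_def defines_variety_def by blast
    \<comment> \<open>The index is taken beyond \<open>k\<close>, so that every identity of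
      \<open>\<Sigma>\<close> has fewer than \<open>n\<close> variables.\<close>
    obtain n where "k < n" and n: "n \<in> index_set" "variety_satisfies V (sigma n)"
      using assms(7) unfolding infinite_nat_iff_unbounded by blast
    then interpret sigma_index n
      by unfold_locales (auto simp: index_set_def)
    have "variety_satisfies V e" if "e \<in> \<Sigma>" for e
      using that by (auto simp: V models_def variety_satisfies_def)
    then have "satisfies H_alg e \<and> satisfies D_alg e \<and> satisfies (G_alg 2) e \<and> satisfies (G_alg 3) e"
      if "e \<in> \<Sigma>" for e
      using that assms(3-6) ai_algebra_H_alg ai_algebra_D_alg ai_algebra_G_alg[of 2] ai_algebra_G_alg[of 3]
      by (simp add: satisfies_variety_contains)
    then obtain S :: "'a ai_alg" where "S \<in> models \<Sigma>" "\<not> satisfies S (sigma n)"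
      using model_not_sigma[OF assms(1)] k \<open>k < n\<close> by (metis le_less_trans)
    then show False
      using n(2) by (auto simp: V variety_satisfies_def)
  qed
  \<comment> \<open>In a finite basis the numbers of variables have a maximum, which serves as the
    bound.\<close>
  moreover have "bounded_variable_basis V" if "finite \<Sigma>" "defines_variety \<Sigma> V" for \<Sigma>
    unfolding bounded_variable_basis_def
    using that by (intro exI[of _ "Max ((\<lambda>e. card (id_vars e)) ` \<Sigma>)"] exI[of _ \<Sigma>]) auto
  ultimately show ?thesis
    unfolding nonfinitely_based_def by blast
qed

end
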